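(* Let $X=(X_1,\ldots,X_N)$ denote binary treatments assigned independently by Bernoulli randomization, and let $Y=(Y_1,\ldots,Y_N)$ denote binary outcomes generated under arbitrary interference. Let the following hold: $$\operatorname{Var}(T)\ge cN,$$ $$\sum_{j:j\ne i}1\{|\eta_i\cap\eta_j|>0\}\le D,\qquad i=1,\ldots,N,$$ $$P_{ii}=p,\qquad i=1,\ldots,N,$$ for constants $c>0$, $D$, and $p$ which are fixed as $N\to\infty$. Then it holds with probability converging to at least $1-\alpha$ that $$\tau^{Z\mathrm{CAT}}\ge\Delta_{Y,Z}-\frac{z_{1-\alpha}}{2p(1-p)}\cdot\sqrt{\frac{\lambda_1}{N}}$$ and $$\left|\Delta_{Y,Z}-\tau^{Z\mathrm{CAT}}\right|\le\frac{z_{1-\alpha/2}}{2p(1-p)}\cdot\sqrt{\frac{\lambda_1}{N}},$$ where $\lambda_1$ is the largest eigenvalue of $\left(I-\frac{\mathbf{1}\mathbf{1}^T}{N}\right)P\left(I-\frac{\mathbf{1}\mathbf{1}^T}{N}\right)$.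
   Context: There are $N$ units, with treatments $X_i$ i.i.d. $\mathrm{Bernoulli}(\rho)$. Arbitrary interference means that each outcome is an idiosyncratic function of all $N$ treatments, $Y_i=f_i(X_1,\ldots,X_N)$, with no restriction on the $f_i$ other than that the outcomes are binary. For each $i$, $\eta_i\subset\{1,\ldots,N\}$ is a given set consisting of $i$ and its neighborhood, and $h_i$ is a given $\{0,1\}$-valued function (exposure mapping); the effective treatments are $Z_i=h_i(\{X_j:j\in\eta_i\})$, $Z=(Z_1,\ldots,Z_N)$, and $L=\sum_{i=1}^N Z_i$. $P\in\mathbb{R}^{N\times N}$ has entries $P_{ij}=\mathbb{P}(Z_iZ_j=1)$. $\xi_i=f_i(0,\ldots,0)$ is the counterfactual outcome of unit $i$ under full control, $\bar\xi=\frac1N\sum_{i=1}^N\xi_i$, and $T=T(Z;\xi)=\sum_{i=1}^N(\xi_i-\bar\xi)Z_i$. Define $$\Delta_{Y,Z}=\frac1L\sum_{i:Z_i=1}Y_i-\frac1{N-L}\sum_{i:Z_i=0}Y_i,\qquad \Delta_{\xi,Z}=\frac1L\sum_{i:Z_i=1}\xi_i-\frac1{N-L}\sum_{i:Z_i=0}\xi_i,$$ and the $Z$-induced contrast attributable to treatment $\tau^{Z\mathrm{CAT}}=\Delta_{Y,Z}-\Delta_{\xi,Z}$. $I$ is the identity matrix, $\mathbf{1}$ the all-ones vector, and $z_q$ the $q$-quantile of the standard normal distribution.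
   Formalization: The two bounds are each asserted separately with limiting probability at least 1−α (jointly this fails), and the one-sided bound is asserted only for α ≤ 1/2, since for α > 1/2 the quantile is negative and the claim is false (e.g. Z_i = X_i with mean of ξ equal to 0.1). *)

theory Defs
  imports "HOL-Probability.Probability" "Jordan_Normal_Form.Spectral_Radius"
begin

(* Units are numbered 0, ..., N - 1, matching the index range of "mat N N".
   Binary quantities are bool-valued and enter arithmetic through of_bool. *)

definition exposure_count :: "nat \<Rightarrow> (nat \<Rightarrow> bool) \<Rightarrow> real" where
  "exposure_count N z = (\<Sum>i<N. of_bool (z i))"

(* Delta_{v,z}. If z is constant on the units, one of the two group means is undefined
   on paper; here it is 0 because x / 0 = 0. *)
definition contrast :: "nat \<Rightarrow> (nat \<Rightarrow> bool) \<Rightarrow> (nat \<Rightarrow> bool) \<Rightarrow> real" where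
  "contrast N v z =
     (1 / exposure_count N z) * (\<Sum>i \<in> {i. i < N \<and> z i}. of_bool (v i))
     - (1 / (real N - exposure_count N z)) * (\<Sum>i \<in> {i. i < N \<and> \<not> z i}. of_bool (v i))"

(* The contrast attributable to treatment: y observed outcomes, xi outcomes under full
   control, z effective treatments. *)
definition tau_ZCAT :: "nat \<Rightarrow> (nat \<Rightarrow> bool) \<Rightarrow> (nat \<Rightarrow> bool) \<Rightarrow> (nat \<Rightarrow> bool) \<Rightarrow> real" where
  "tau_ZCAT N y xi z = contrast N y z - contrast N xi z"

definition unit_mean :: "nat \<Rightarrow> (nat \<Rightarrow> bool) \<Rightarrow> real" where
  "unit_mean N v = (1 / real N) * (\<Sum>i<N. of_bool (v i))"

definition T_stat :: "nat \<Rightarrow> (nat \<Rightarrow> bool) \<Rightarrow> (nat \<Rightarrow> bool) \<Rightarrow> real" where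
  "T_stat N z xi = (\<Sum>i<N. (of_bool (xi i) - unit_mean N xi) * of_bool (z i))"

definition joint_exposure_matrix :: "'a measure \<Rightarrow> nat \<Rightarrow> (nat \<Rightarrow> 'a \<Rightarrow> bool) \<Rightarrow> real mat" where
  "joint_exposure_matrix M N Z =
     mat N N (\<lambda>(i, j). measure M {\<omega> \<in> space M. Z i \<omega> \<and> Z j \<omega>})"

definition centering_matrix :: "nat \<Rightarrow> real mat" where
  "centering_matrix N = 1\<^sub>m N - (1 / real N) \<cdot>\<^sub>m mat N N (\<lambda>_. 1)"

(* Meaningful for a symmetric matrix of positive size: its real spectrum is then finite
   and nonempty, and contains all its eigenvalues. *)
definition largest_eigenvalue :: "real mat \<Rightarrow> real" where
  "largest_eigenvalue A = Max (spectrum A)"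

definition lambda1 :: "'a measure \<Rightarrow> nat \<Rightarrow> (nat \<Rightarrow> 'a \<Rightarrow> bool) \<Rightarrow> real" where
  "lambda1 M N Z =
     largest_eigenvalue (centering_matrix N * joint_exposure_matrix M N Z * centering_matrix N)"

(* For 0 < q < 1 *)
definition normal_quantile :: "real \<Rightarrow> real" where
  "normal_quantile q = Inf {x. q \<le> cdf std_normal_distribution x}"

end

theory Submission
  imports Defs "HOL-Real_Asymp.Real_Asymp"
begin

text \<open>The difference \<open>\<Delta>\<^sub>Y - \<tau>\<close> is the contrast of the full-control outcomes, which equals
  \<open>N T / (L (N - L))\<close>. Up to the factor \<open>N\<^sup>2 p (1 - p) / (L (N - L))\<close>, which tends to \<open>1\<close> in
  probability by Chebyshev's inequality, it is therefore \<open>T / (N p (1 - p))\<close>. As \<open>T\<close> has mean \<open>0\<close>,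
  its variance is the quadratic form of \<open>P\<close> at the centred vector \<open>\<xi> - \<xi>bar\<close>, hence at most
  \<open>\<lambda>\<^sub>1 N / 4\<close>. Finally \<open>T\<close> is a sum of bounded variables with a dependency graph of bounded
  degree and variance of order \<open>N\<close>, so its standardisation is asymptotically normal. The central
  limit theorem for such sums is proved through the characteristic function, by showing that it
  almost satisfies \<open>\<phi>' = - t \<phi>\<close>.\<close>

section \<open>The largest eigenvalue of a symmetric matrix\<close>

text \<open>The bound on Var(T) goes only one way and \<open>lambda1\<close> varies with
  \<open>N\<close>, so in units of the standard deviation of \<open>T\<close> the threshold need not
  converge, and Slutsky's theorem gives nothing directly. The random factor is therefore absorbed
  pointwise: off an event of probability O(1/N), replacing L/N by \<open>p\<close> costs at most a
  factor 1 + \<epsilon>, which is paid for by shrinking the quantile \<open>z\<close> to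
  \<open>z / (1 + \<epsilon>)\<close>. Only after \<open>N\<close> has tended to infinity does
  \<epsilon> tend to 0, which leaves a lower bound on a liminf. Dependence rules out a product
  formula for the characteristic function. The differential inequality gets by with two facts: each
  summand is independent of the sum outside its neighbourhood, and the sum over neighbouring pairs
  has small variance. For each \<open>N\<close> all randomness sits in finitely many binary
  coordinates, so every random quantity is a simple function; measurability, integrability and
  differentiation under the expectation become finite statements. That \<open>p\<close> lies
  strictly between 0 and 1 is extracted from the positivity of Var(T).\<close>

lemma compact_unit_sphere_fun:
  "compact {x :: nat \<Rightarrow> real. (\<forall>i\<ge>n. x i = 0) \<and> (\<Sum>i<n. (x i)\<^sup>2) = 1}" (is "compact ?S")
proof -
  \<comment> \<open>Vectors of length \<open>n\<close> are functions that vanish from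
    \<open>n\<close> on. This places the sphere in a product of compact sets, where Tychonoff's
    theorem applies.\<close>
  define F :: "nat \<Rightarrow> real set" where "F i = (if i < n then {-1..1} else {0})" for i
  have "compactin (product_topology (\<lambda>i. euclidean) UNIV) (Pi\<^sub>E UNIV F)"
    unfolding compactin_PiE by (auto simp: F_def)
  then have comp: "compact (Pi\<^sub>E UNIV F)"
    by (simp add: euclidean_product_topology)
  have "closed {x :: nat \<Rightarrow> real. (\<Sum>i<n. (x i)\<^sup>2) = 1}"
    by (intro closed_Collect_eq continuous_intros
        continuous_on_subset[OF continuous_on_product_coordinates]) auto
  then have "compact (Pi\<^sub>E UNIV F \<inter> {x. (\<Sum>i<n. (x i)\<^sup>2) = 1})"
    by (rule compact_Int_closed[OF comp])
  moreover have "?S = Pi\<^sub>E UNIV F \<inter> {x. (\<Sum>i<n. (x i)\<^sup>2) = 1}"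
  proof (rule Set.set_eqI)
    fix x :: "nat \<Rightarrow> real"
    have "\<bar>x i\<bar> \<le> 1" if "(\<Sum>i<n. (x i)\<^sup>2) = 1" "i < n" for i
    proof -
      have "(x i)\<^sup>2 \<le> (\<Sum>i<n. (x i)\<^sup>2)"
        using that(2) by (intro member_le_sum) auto
      with that(1) show ?thesis by (simp add: abs_square_le_1)
    qed
    then show "x \<in> ?S \<longleftrightarrow> x \<in> Pi\<^sub>E UNIV F \<inter> {x. (\<Sum>i<n. (x i)\<^sup>2) = 1}"
      by (simp add: F_def PiE_iff abs_le_iff minus_le_iff not_less) (smt (verit) not_less)
  qed
  ultimately show ?thesis by simp
qed

text \<open>The maximiser of the quadratic form on the unit sphere is an eigenvector; its eigenvalue
  is the maximum. Perturbing it by \<open>\<epsilon>\<close> in a direction \<open>y\<close> gives an inequality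
  \<open>2 \<epsilon> b + \<epsilon>\<^sup>2 s \<ge> 0\<close> for all \<open>\<epsilon>\<close>, so that \<open>b = 0\<close>.\<close>

lemma symmetric_form_maximiser:
  fixes a :: "nat \<Rightarrow> nat \<Rightarrow> real"
  assumes n: "n > 0" and sym: "\<And>i j. i < n \<Longrightarrow> j < n \<Longrightarrow> a i j = a j i"
  shows "\<exists>\<mu> x. (\<exists>i<n. x i \<noteq> 0) \<and> (\<forall>i<n. (\<Sum>j<n. a i j * x j) = \<mu> * x i) \<and>
    (\<forall>y. (\<Sum>i<n. \<Sum>j<n. a i j * y i * y j) \<le> \<mu> * (\<Sum>i<n. (y i)\<^sup>2))"
proof -
  define q where "q y = (\<Sum>i<n. \<Sum>j<n. a i j * y i * y j)" for y
  define s where "s y = (\<Sum>i<n. (y i)\<^sup>2)" for y :: "nat \<Rightarrow> real"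
  let ?S = "{x :: nat \<Rightarrow> real. (\<forall>i\<ge>n. x i = 0) \<and> s x = 1}"
  have "s (\<lambda>i. of_bool (i = 0)) = (\<Sum>i<n. if i = 0 then 1 else 0)"
    unfolding s_def by (intro sum.cong) auto
  with n have "(\<lambda>i. of_bool (i = 0)) \<in> ?S"
    by simp
  then have ne: "?S \<noteq> {}" by (metis empty_iff)
  have "continuous_on ?S q"
    unfolding q_def
    by (intro continuous_intros continuous_on_subset[OF continuous_on_product_coordinates]) auto
  moreover have "compact ?S"
    unfolding s_def by (rule compact_unit_sphere_fun)
  ultimately obtain x where x: "x \<in> ?S" and max: "\<And>y. y \<in> ?S \<Longrightarrow> q y \<le> q x"
    using continuous_attains_sup[of ?S q] ne by auto
  define \<mu> where "\<mu> = q x"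
  \<comment> \<open>Both sides are homogeneous of degree 2, so the bound on the sphere extends to
    every vector. Entries of \<open>y\<close> from \<open>n\<close> on enter neither side;
    \<open>z\<close> cuts them off in order to land in \<open>?S\<close>.\<close>
  have bound: "q y \<le> \<mu> * s y" for y
  proof (cases "s y = 0")
    case True
    then have "\<And>i. i < n \<Longrightarrow> y i = 0"
      unfolding s_def by (subst (asm) sum_nonneg_eq_0_iff) auto
    then show ?thesis by (simp add: q_def s_def)
  next
    case False
    have "s y \<ge> 0" unfolding s_def by (intro sum_nonneg) auto
    with False have pos: "s y > 0" by simp
    define z where "z i = (if i < n then y i / sqrt (s y) else 0)" for i
    have "s z = (\<Sum>i<n. (y i)\<^sup>2 / s y)"
      unfolding s_def[of z] using pos by (intro sum.cong) (auto simp: z_def power_divide)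
    also have "\<dots> = 1" using pos by (simp add: s_def[of y] flip: sum_divide_distrib)
    finally have "z \<in> ?S" by (auto simp: z_def)
    from max[OF this] have le: "q z \<le> \<mu>" by (simp add: \<mu>_def)
    have "q z = (\<Sum>i<n. \<Sum>j<n. a i j * y i * y j / s y)"
      unfolding q_def using pos by (intro sum.cong refl) (simp add: z_def)
    also have "\<dots> = q y / s y" by (simp add: q_def sum_divide_distrib)
    finally show ?thesis using le pos by (simp add: pos_divide_le_eq)
  qed
  have eig: "(\<Sum>j<n. a k j * x j) = \<mu> * x k" if k: "k < n" for k
  proof -
    define b where "b = \<mu> * x k - (\<Sum>j<n. a k j * x j)"
    define e where "e i = (if i = k then 1 else 0 :: real)" for i
    define d where "d = \<mu> - a k k"
    have sx: "s x = 1" using x by simp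
    have s: "s (\<lambda>i. x i + t * e i) = s x + 2 * t * x k + t\<^sup>2" for t
    proof -
      have "s (\<lambda>i. x i + t * e i) = (\<Sum>i<n. (x i)\<^sup>2 + (2 * t * x i + t\<^sup>2) * e i)"
        unfolding s_def by (intro sum.cong) (auto simp: e_def power2_sum)
      also have "\<dots> = s x + (2 * t * x k + t\<^sup>2)"
        using k by (simp add: s_def sum.distrib e_def mult_delta_right)
      finally show ?thesis by simp
    qed
    have q: "q (\<lambda>i. x i + t * e i) = q x + 2 * t * (\<Sum>j<n. a k j * x j) + t\<^sup>2 * a k k" for t
    proof -
      have "q (\<lambda>i. x i + t * e i) = (\<Sum>i<n. \<Sum>j<n. a i j * x i * x j + t * a i j * x j * e i
          + t * a i j * x i * e j + t\<^sup>2 * a i j * e i * e j)"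
        unfolding q_def by (intro sum.cong refl) (simp add: algebra_simps power2_eq_square)
      also have "\<dots> = q x + (\<Sum>i<n. \<Sum>j<n. t * a i j * x j * e i) + (\<Sum>i<n. \<Sum>j<n. t * a i j * x i * e j)
         + (\<Sum>i<n. \<Sum>j<n. t\<^sup>2 * a i j * e i * e j)"
        by (simp add: q_def sum.distrib)
      also have "(\<Sum>i<n. \<Sum>j<n. t * a i j * x j * e i) = (\<Sum>i<n. (\<Sum>j<n. t * a i j * x j) * e i)"
        by (simp add: sum_distrib_right)
      also have "\<dots> = t * (\<Sum>j<n. a k j * x j)"
        using k by (simp add: e_def mult_delta_right sum_distrib_left mult.assoc)
      also have "(\<Sum>i<n. \<Sum>j<n. t * a i j * x i * e j) = (\<Sum>i<n. t * a i k * x i)"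
        using k by (simp add: e_def mult_delta_right)
      also have "\<dots> = t * (\<Sum>j<n. a k j * x j)"
        unfolding sum_distrib_left using k sym by (intro sum.cong) (auto simp: mult_ac)
      also have "(\<Sum>i<n. \<Sum>j<n. t\<^sup>2 * a i j * e i * e j) = t\<^sup>2 * a k k"
        using k by (simp add: e_def mult_delta_right)
      finally show ?thesis by (simp add: algebra_simps)
    qed
    have ineq: "0 \<le> 2 * t * b + t\<^sup>2 * d" for t
      using bound[of "\<lambda>i. x i + t * e i"] unfolding s q sx \<mu>_def[symmetric]
      by (simp add: b_def d_def algebra_simps)
    have d: "d \<ge> 0"
      using ineq[of 1] ineq[of "-1"] by simp
    \<comment> \<open>The quadratic is minimal at \<open>- b / d\<close>; since only
      \<open>d \<ge> 0\<close> is known, \<open>d + 1\<close> takes the place of \<open>d\<close>,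
      and the value is still negative unless \<open>b = 0\<close>.\<close>
    have "0 \<le> 2 * (- b / (d + 1)) * b + (- b / (d + 1))\<^sup>2 * d" by (rule ineq)
    also have "\<dots> = - (b\<^sup>2 * (d + 2)) / (d + 1)\<^sup>2"
      using d by (simp add: divide_simps power2_eq_square) (simp add: algebra_simps)
    finally have "b\<^sup>2 * (d + 2) \<le> 0"
      using d by (simp add: pos_divide_le_eq)
    then have "b = 0" using d by (simp add: mult_le_0_iff)
    then show ?thesis by (simp add: b_def)
  qed
  have "\<exists>i<n. x i \<noteq> 0"
  proof (rule ccontr)
    assume "\<not> (\<exists>i<n. x i \<noteq> 0)"
    then have "s x = 0" by (simp add: s_def)
    with x show False by simp
  qed
  then show ?thesis
    using eig bound unfolding q_def s_def by (intro exI[of _ \<mu>] exI[of _ x]) simp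
qed

text \<open>No diagonalisation is required: the maximum \<mu> of the Rayleigh quotient is one
  element of the finite spectrum, hence at most its \<open>Max\<close>.\<close>

lemma quadratic_form_le_largest_eigenvalue:
  fixes A :: "real mat"
  assumes A: "A \<in> carrier_mat n n" and n: "n > 0"
    and sym: "\<And>i j. i < n \<Longrightarrow> j < n \<Longrightarrow> A $$ (i, j) = A $$ (j, i)"
  shows "(\<Sum>i<n. \<Sum>j<n. A $$ (i, j) * y i * y j) \<le> largest_eigenvalue A * (\<Sum>i<n. (y i)\<^sup>2)"
proof -
  have "\<exists>\<mu> x. (\<exists>i<n. x i \<noteq> 0) \<and> (\<forall>i<n. (\<Sum>j<n. A $$ (i, j) * x j) = \<mu> * x i) \<and>
      (\<forall>y. (\<Sum>i<n. \<Sum>j<n. A $$ (i, j) * y i * y j) \<le> \<mu> * (\<Sum>i<n. (y i)\<^sup>2))"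
    by (rule symmetric_form_maximiser[OF n]) (rule sym)
  then obtain \<mu> x where x: "\<exists>i<n. x i \<noteq> 0" "\<forall>i<n. (\<Sum>j<n. A $$ (i, j) * x j) = \<mu> * x i"
    and le: "\<forall>y. (\<Sum>i<n. \<Sum>j<n. A $$ (i, j) * y i * y j) \<le> \<mu> * (\<Sum>i<n. (y i)\<^sup>2)"
    by blast
  have "eigenvector A (Matrix.vec n x) \<mu>"
    unfolding eigenvector_def
  proof (intro conjI)
    show "Matrix.vec n x \<noteq> 0\<^sub>v (dim_row A)"
      using x(1) A by (metis carrier_matD(1) index_vec index_zero_vec(1))
    show "A *\<^sub>v Matrix.vec n x = \<mu> \<cdot>\<^sub>v Matrix.vec n x"
      using A x(2) by (intro eq_vecI) (auto simp: scalar_prod_def atLeast0LessThan)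
  qed (use A in auto)
  then have "\<mu> \<in> spectrum A"
    by (auto simp: spectrum_def eigenvalue_def)
  then have "\<mu> \<le> largest_eigenvalue A"
    unfolding largest_eigenvalue_def using card_finite_spectrum(1)[OF A] by (intro Max_ge)
  then show ?thesis
    using spec[OF le, of y] by (meson mult_right_mono order_trans sum_nonneg zero_le_power2)
qed

text \<open>Centring fixes every vector whose entries sum to 0, so the forms of \<open>P\<close> and
  of \<open>C * P * C\<close> agree at \<open>v\<close>, and the eigenvalue bound for the latter
  applies.\<close>

lemma centered_quadratic_form_le_lambda1:
  assumes n: "n > 0" and v: "(\<Sum>i<n. v i) = 0"
  shows "(\<Sum>i<n. \<Sum>j<n. joint_exposure_matrix M n Z $$ (i, j) * v i * v j)
    \<le> lambda1 M n Z * (\<Sum>i<n. (v i)\<^sup>2)"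
proof -
  define C where "C = centering_matrix n"
  define P where "P = joint_exposure_matrix M n Z"
  have C: "C \<in> carrier_mat n n" and P: "P \<in> carrier_mat n n"
    by (auto simp: C_def P_def centering_matrix_def joint_exposure_matrix_def)
  have C_entry: "C $$ (i, j) = of_bool (i = j) - 1 / real n" if "i < n" "j < n" for i j
    using that by (simp add: C_def centering_matrix_def)
  have P_sym: "P $$ (i, j) = P $$ (j, i)" if "i < n" "j < n" for i j
    using that by (simp add: P_def joint_exposure_matrix_def conj_commute)
  have entry: "(C * P * C) $$ (i, j) = (\<Sum>l<n. \<Sum>k<n. C $$ (i, k) * P $$ (k, l) * C $$ (l, j))"
    if "i < n" "j < n" for i j
  proof -
    have "(C * P * C) $$ (i, j) = (\<Sum>l<n. (C * P) $$ (i, l) * C $$ (l, j))"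
      using that C P by (simp add: scalar_prod_def atLeast0LessThan del: assoc_mult_mat)
    also have "\<dots> = (\<Sum>l<n. (\<Sum>k<n. C $$ (i, k) * P $$ (k, l)) * C $$ (l, j))"
      using that C P by (intro sum.cong) (auto simp: scalar_prod_def atLeast0LessThan)
    finally show ?thesis by (simp add: sum_distrib_right)
  qed
  have Cv: "(\<Sum>j<n. C $$ (k, j) * v j) = v k" and Cv': "(\<Sum>j<n. C $$ (j, k) * v j) = v k" if "k < n" for k
    using that v by (simp_all add: C_entry left_diff_distrib sum_subtractf of_bool_def
        if_distrib[of "\<lambda>z. z * _"] flip: sum_divide_distrib cong: if_cong)
  have C_sym: "C $$ (i, j) = C $$ (j, i)" if "i < n" "j < n" for i j
    using that by (simp add: C_entry eq_commute)
  have inner: "(\<Sum>j<n. (C * P * C) $$ (i, j) * v i * v j) = (\<Sum>l<n. \<Sum>k<n. P $$ (k, l) * v l * (C $$ (i, k) * v i))"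
    if "i < n" for i
  proof -
    have "(\<Sum>j<n. (C * P * C) $$ (i, j) * v i * v j)
        = (\<Sum>j<n. \<Sum>l<n. (\<Sum>k<n. C $$ (i, k) * P $$ (k, l) * v i) * (C $$ (l, j) * v j))"
      by (intro sum.cong refl) (simp add: entry[OF that] sum_distrib_left sum_distrib_right mult_ac)
    also have "\<dots> = (\<Sum>l<n. (\<Sum>k<n. C $$ (i, k) * P $$ (k, l) * v i) * (\<Sum>j<n. C $$ (l, j) * v j))"
      by (subst sum.swap) (simp add: sum_distrib_left)
    also have "\<dots> = (\<Sum>l<n. (\<Sum>k<n. C $$ (i, k) * P $$ (k, l) * v i) * v l)"
      by (intro sum.cong refl) (simp add: Cv)
    finally show ?thesis by (simp add: sum_distrib_left sum_distrib_right mult_ac)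
  qed
  have "(\<Sum>i<n. \<Sum>j<n. (C * P * C) $$ (i, j) * v i * v j)
      = (\<Sum>i<n. \<Sum>l<n. \<Sum>k<n. P $$ (k, l) * v l * (C $$ (i, k) * v i))"
    by (intro sum.cong refl inner) simp
  also have "\<dots> = (\<Sum>l<n. \<Sum>i<n. \<Sum>k<n. P $$ (k, l) * v l * (C $$ (i, k) * v i))"
    by (rule sum.swap)
  also have "\<dots> = (\<Sum>l<n. \<Sum>k<n. \<Sum>i<n. P $$ (k, l) * v l * (C $$ (i, k) * v i))"
    by (intro sum.cong refl sum.swap)
  also have "\<dots> = (\<Sum>l<n. \<Sum>k<n. P $$ (k, l) * v l * v k)"
    by (intro sum.cong refl) (simp add: Cv' flip: sum_distrib_left)
  also have "\<dots> = (\<Sum>i<n. \<Sum>j<n. P $$ (i, j) * v i * v j)"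
    by (subst sum.swap) (simp add: mult_ac)
  finally have "(\<Sum>i<n. \<Sum>j<n. P $$ (i, j) * v i * v j)
      = (\<Sum>i<n. \<Sum>j<n. (C * P * C) $$ (i, j) * v i * v j)" ..
  also have "\<dots> \<le> largest_eigenvalue (C * P * C) * (\<Sum>i<n. (v i)\<^sup>2)"
  proof (rule quadratic_form_le_largest_eigenvalue[OF _ n])
    fix i j assume ij: "i < n" "j < n"
    have "(\<Sum>l<n. \<Sum>k<n. C $$ (i, k) * P $$ (k, l) * C $$ (l, j))
        = (\<Sum>k<n. \<Sum>l<n. C $$ (i, k) * P $$ (k, l) * C $$ (l, j))"
      by (rule sum.swap)
    also have "\<dots> = (\<Sum>k<n. \<Sum>l<n. C $$ (j, l) * P $$ (l, k) * C $$ (k, i))"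
    proof (intro sum.cong refl)
      fix k l assume "k \<in> {..<n}" "l \<in> {..<n}"
      then show "C $$ (i, k) * P $$ (k, l) * C $$ (l, j) = C $$ (j, l) * P $$ (l, k) * C $$ (k, i)"
        using C_sym[of i k] C_sym[of l j] P_sym[of k l] ij by simp
    qed
    finally show "(C * P * C) $$ (i, j) = (C * P * C) $$ (j, i)"
      unfolding entry[OF ij] entry[OF ij(2,1)] .
  qed (use C P in auto)
  finally show ?thesis unfolding lambda1_def C_def P_def .
qed

section \<open>The standard normal distribution function\<close>

interpretation std_normal: real_distribution std_normal_distribution
  by (rule real_dist_normal_dist)

lemma isCont_cdf_std_normal: "isCont (cdf std_normal_distribution) x"
proof -
  have "{x} \<in> null_sets std_normal_distribution"
  proof -
    have "AE y in lborel. y \<notin> {x}"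
      by (intro AE_not_in) auto
    then have "AE y\<in>{x} in lborel. ennreal (std_normal_density y) = 0"
      by eventually_elim simp
    then show ?thesis by (subst null_sets_density_iff) auto
  qed
  then show ?thesis
    unfolding std_normal.isCont_cdf by (rule measure_eq_0_null_sets)
qed

lemma cdf_std_normal_uminus: "cdf std_normal_distribution (- x) = 1 - cdf std_normal_distribution x"
proof -
  have d: "distributed std_normal_distribution lborel (\<lambda>x. x) std_normal_density"
    unfolding distributed_def by (auto simp: distr_id2 cong: distr_cong)
  have "distributed std_normal_distribution lborel (\<lambda>x. 0 + (-1) * x)
      (normal_density (0 + (-1) * 0) (\<bar>-1\<bar> * 1))"
    by (rule std_normal.normal_density_affine[OF d]) auto
  then have "distr std_normal_distribution lborel uminus = std_normal_distribution"
    by (simp add: distributed_def)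
  then have "cdf std_normal_distribution (- x) = measure (distr std_normal_distribution lborel uminus) {..-x}"
    by (simp add: cdf_def)
  also have "\<dots> = measure std_normal_distribution {x..}"
    by (subst measure_distr) (auto intro!: arg_cong[where f="measure _"])
  also have "\<dots> = 1 - measure std_normal_distribution {..<x}"
    using std_normal.prob_compl[of "{..<x}"] by (simp add: Compl_eq_Diff_UNIV[symmetric] Compl_lessThan)
  \<comment> \<open>Reflection turns a closed half line into the complement of an open one;
    continuity of the distribution function restores the missing end point.\<close>
  also have "measure std_normal_distribution {..<x} = cdf std_normal_distribution x"
    using isCont_cdf_std_normal[of x, unfolded std_normal.isCont_cdf]
    unfolding cdf_def ivl_disj_un(2)[symmetric] by (subst std_normal.finite_measure_Union) auto
  finally show ?thesis .
qed

lemma cdf_std_normal_0: "cdf std_normal_distribution 0 = 1 / 2"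
  using cdf_std_normal_uminus[of 0] by simp

text \<open>The density is positive, so the interval from \<open>x\<close> to 0 carries mass.
  Strictness is what forces quantiles of level at least 1/2 to be nonnegative.\<close>

lemma cdf_std_normal_less_half:
  assumes "x < 0"
  shows "cdf std_normal_distribution x < 1 / 2"
proof -
  have "measure std_normal_distribution {x<..0} \<noteq> 0"
  proof
    assume "measure std_normal_distribution {x<..0} = 0"
    then have "{x<..0} \<in> null_sets std_normal_distribution"
      by (auto simp: std_normal.emeasure_eq_measure null_sets_def)
    then have "AE y\<in>{x<..0} in lborel. std_normal_density y = 0"
      by (subst (asm) null_sets_density_iff) auto
    then have "AE y in lborel. y \<notin> {x<..0}"
      by eventually_elim (use normal_density_pos[of 1 0] in \<open>force simp: less_le\<close>)
    then have "{x<..0} \<in> null_sets lborel"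
      by (subst AE_iff_null_sets) auto
    then show False using assms by (auto simp: null_sets_def)
  qed
  then have "measure std_normal_distribution {x<..0} > 0"
    by (simp add: less_le)
  then show ?thesis
    using std_normal.cdf_diff_eq[OF assms] by (simp add: cdf_std_normal_0)
qed

text \<open>By right continuity the infimum is attained; \<open>pseudoinverse\<close> states this as
  an adjunction, here taken at the quantile itself. An inequality suffices because coverage is only
  bounded from below.\<close>

lemma cdf_normal_quantile_ge:
  assumes "0 < q" "q < 1"
  shows "q \<le> cdf std_normal_distribution (normal_quantile q)"
proof -
  interpret cdf_distribution std_normal_distribution
    by (simp add: cdf_distribution_def std_normal.real_distribution_axioms)
  show ?thesis
    unfolding normal_quantile_def using pseudoinverse[OF assms] by blast
qed

lemma normal_quantile_nonneg:
  assumes "1 / 2 \<le> q" "q < 1"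
  shows "0 \<le> normal_quantile q"
proof (rule ccontr)
  assume "\<not> 0 \<le> normal_quantile q"
  then have "cdf std_normal_distribution (normal_quantile q) < 1 / 2"
    by (intro cdf_std_normal_less_half) simp
  with cdf_normal_quantile_ge[of q] assms show False by simp
qed

section \<open>Functions of disjoint blocks of independent variables\<close>

text \<open>Each row has at most \<open>m\<close> nonzero entries, so the double sum grows linearly
  in \<open>card K\<close> and not quadratically.\<close>

lemma sum_dependent_pairs_bound:
  fixes c :: "nat \<Rightarrow> nat \<Rightarrow> real"
  assumes "finite K" and C: "C \<ge> 0"
    and le: "\<And>i j. i \<in> K \<Longrightarrow> j \<in> K \<Longrightarrow> c i j \<le> C"
    and zero: "\<And>i j. i \<in> K \<Longrightarrow> j \<in> K \<Longrightarrow> \<not> R i j \<Longrightarrow> c i j = 0"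
    and m: "\<And>i. i \<in> K \<Longrightarrow> card {j \<in> K. R i j} \<le> m"
  shows "(\<Sum>i\<in>K. \<Sum>j\<in>K. c i j) \<le> real (card K) * real m * C"
proof -
  have "(\<Sum>j\<in>K. c i j) \<le> real m * C" if i: "i \<in> K" for i
  proof -
    have "(\<Sum>j\<in>K. c i j) = (\<Sum>j\<in>{j \<in> K. R i j}. c i j)"
      using assms(1) zero[OF i] by (intro sum.mono_neutral_right) auto
    also have "\<dots> \<le> real (card {j \<in> K. R i j}) * C"
      using le[OF i] by (intro sum_bounded_above) auto
    also have "\<dots> \<le> real m * C"
      using m[OF i] C by (intro mult_right_mono) auto
    finally show ?thesis .
  qed
  then have "(\<Sum>i\<in>K. \<Sum>j\<in>K. c i j) \<le> real (card K) * (real m * C)"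
    by (intro sum_bounded_above) auto
  then show ?thesis by simp
qed

locale independent_coordinates = prob_space M for M :: "'a measure" +
  fixes I :: "nat set" and X :: "nat \<Rightarrow> 'a \<Rightarrow> bool"
  assumes finite_I: "finite I"
    and indep_X: "indep_vars (\<lambda>_. count_space UNIV) X I"
begin

text \<open>A pointwise substitute for measurability with respect to the coordinates in
  \<open>A\<close>. It makes sense for values in any type and is stable under arbitrary composition;
  for \<open>A \<subseteq> I\<close> it yields a simple function, since the coordinates in
  \<open>A\<close> take finitely many joint values.\<close>

definition determined :: "nat set \<Rightarrow> ('a \<Rightarrow> 'c) \<Rightarrow> bool" where
  "determined A F \<longleftrightarrow>
    (\<forall>\<omega>\<in>space M. \<forall>\<omega>'\<in>space M. (\<forall>j\<in>A. X j \<omega> = X j \<omega>') \<longrightarrow> F \<omega> = F \<omega>')"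

lemma determinedI:
  "(\<And>\<omega> \<omega>'. \<omega> \<in> space M \<Longrightarrow> \<omega>' \<in> space M \<Longrightarrow> (\<And>j. j \<in> A \<Longrightarrow> X j \<omega> = X j \<omega>') \<Longrightarrow> F \<omega> = F \<omega>')
    \<Longrightarrow> determined A F"
  unfolding determined_def by blast

lemma determinedD:
  "determined A F \<Longrightarrow> \<omega> \<in> space M \<Longrightarrow> \<omega>' \<in> space M \<Longrightarrow> (\<And>j. j \<in> A \<Longrightarrow> X j \<omega> = X j \<omega>') \<Longrightarrow> F \<omega> = F \<omega>'"
  unfolding determined_def by blast

lemma determined_mono: "determined A F \<Longrightarrow> A \<subseteq> B \<Longrightarrow> determined B F"
  unfolding determined_def by blast

lemma determined_comp: "determined A F \<Longrightarrow> determined A (\<lambda>\<omega>. k (F \<omega>))"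
  unfolding determined_def by metis

lemma determined_comp2:
  "determined A F \<Longrightarrow> determined A G \<Longrightarrow> determined A (\<lambda>\<omega>. k (F \<omega>) (G \<omega>))"
  unfolding determined_def by metis

lemma determined_sum:
  "(\<And>i. i \<in> K \<Longrightarrow> determined A (F i)) \<Longrightarrow> determined A (\<lambda>\<omega>. \<Sum>i\<in>K. F i \<omega>)"
  by (rule determinedI, rule sum.cong) (auto intro: determinedD)

abbreviation coords :: "nat set \<Rightarrow> 'a \<Rightarrow> nat \<Rightarrow> bool" where
  "coords A \<omega> \<equiv> restrict (\<lambda>j. X j \<omega>) A"

text \<open>The factor evaluates \<open>F\<close> at a chosen representative of each pattern of
  coordinates. The choice raises no measurability question, because the patterns form a finite
  discrete space once \<open>A \<subseteq> I\<close>.\<close>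

lemma determined_factor:
  assumes "determined A F"
  shows "\<exists>g. \<forall>\<omega>\<in>space M. F \<omega> = g (coords A \<omega>)"
proof (intro exI ballI)
  fix \<omega> assume \<omega>: "\<omega> \<in> space M"
  define \<omega>' where "\<omega>' = (SOME \<omega>'. \<omega>' \<in> space M \<and> coords A \<omega>' = coords A \<omega>)"
  have "\<omega>' \<in> space M \<and> coords A \<omega>' = coords A \<omega>"
    unfolding \<omega>'_def by (rule someI[of _ \<omega>]) (use \<omega> in simp)
  then have "\<omega>' \<in> space M" "\<And>j. j \<in> A \<Longrightarrow> X j \<omega> = X j \<omega>'"
    by (auto dest!: fun_cong simp: restrict_def split: if_splits)
  then show "F \<omega> = (\<lambda>r. F (SOME \<omega>'. \<omega>' \<in> space M \<and> coords A \<omega>' = r)) (coords A \<omega>)"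
    using determinedD[OF assms \<omega>] unfolding \<omega>'_def by blast
qed

lemma random_variable_X: "j \<in> I \<Longrightarrow> random_variable (count_space UNIV) (X j)"
  using indep_X by (auto simp: indep_vars_def)

lemma PiM_coords: "A \<subseteq> I \<Longrightarrow> PiM A (\<lambda>_. count_space (UNIV :: bool set)) = count_space (Pi\<^sub>E A (\<lambda>_. UNIV))"
  using finite_I by (intro count_space_PiM_finite) (auto intro: finite_subset)

lemma measurable_coords:
  assumes "A \<subseteq> I"
  shows "coords A \<in> M \<rightarrow>\<^sub>M count_space (Pi\<^sub>E A (\<lambda>_. UNIV))"
  unfolding PiM_coords[OF assms, symmetric]
  using assms random_variable_X by (intro measurable_restrict) auto

lemma simple_function_determined:
  assumes "determined A F" "A \<subseteq> I"
  shows "simple_function M F"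
proof -
  from determined_factor[OF assms(1)] obtain g
    where g: "\<And>\<omega>. \<omega> \<in> space M \<Longrightarrow> F \<omega> = g (coords A \<omega>)"
    by (elim exE) (rule that, rule bspec)
  have "finite A" using assms(2) finite_I by (rule finite_subset)
  then have "finite (Pi\<^sub>E A (\<lambda>_. UNIV :: bool set))"
    by (intro finite_PiE) auto
  moreover have "coords A ` space M \<subseteq> Pi\<^sub>E A (\<lambda>_. UNIV)"
    by auto
  ultimately have fin: "finite (coords A ` space M)"
    by (rule finite_subset[rotated])
  have "simple_function M (coords A)"
    unfolding simple_function_def
  proof (intro conjI ballI fin)
    fix r assume "r \<in> coords A ` space M"
    then show "coords A -` {r} \<inter> space M \<in> sets M"
      by (intro measurable_sets[OF measurable_coords[OF assms(2)]]) auto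
  qed
  then have "simple_function M (\<lambda>\<omega>. g (coords A \<omega>))"
    by (rule simple_function_compose1)
  then show ?thesis
    by (subst simple_function_cong[OF g]) 
qed

lemma random_variable_determined:
  "determined A F \<Longrightarrow> A \<subseteq> I \<Longrightarrow> random_variable borel (F :: 'a \<Rightarrow> 'c :: topological_space)"
  by (rule borel_measurable_simple_function) (rule simple_function_determined)

lemma integrable_determined:
  fixes F :: "'a \<Rightarrow> 'c :: {banach, second_countable_topology}"
  assumes "determined A F" "A \<subseteq> I"
  shows "integrable M F"
  using simple_function_determined[OF assms] emeasure_space_1
  by (intro integrableI_simple_bochner_integrable simple_bochner_integrable.intros) (auto simp: emeasure_eq_measure)

text \<open>Disjoint blocks of independent coordinates are independent, and so are functions of
  them. This is the one place where independence of the coordinates enters, beyond their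
  measurability.\<close>

lemma expectation_mult_determined:
  fixes F G :: "'a \<Rightarrow> 'c :: {real_normed_field, banach, second_countable_topology}"
  assumes F: "determined A F" and G: "determined B G"
    and AB: "A \<subseteq> I" "B \<subseteq> I" "A \<inter> B = {}"
  shows "expectation (\<lambda>\<omega>. F \<omega> * G \<omega>) = expectation F * expectation G"
proof -
  from determined_factor[OF F] obtain f
    where f: "\<And>\<omega>. \<omega> \<in> space M \<Longrightarrow> F \<omega> = f (coords A \<omega>)"
    by (elim exE) (rule that, rule bspec)
  from determined_factor[OF G] obtain g
    where g: "\<And>\<omega>. \<omega> \<in> space M \<Longrightarrow> G \<omega> = g (coords B \<omega>)"
    by (elim exE) (rule that, rule bspec)
  have "indep_var (PiM A (\<lambda>_. count_space UNIV)) (coords A) (PiM B (\<lambda>_. count_space UNIV)) (coords B)"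
    using indep_var_restrict[OF indep_X AB(3,1,2)] .
  then have indep: "indep_var borel (f \<circ> coords A) borel (g \<circ> coords B)"
    by (rule indep_var_compose) (use AB in \<open>simp_all add: PiM_coords\<close>)
  have int: "integrable M (f \<circ> coords A)" "integrable M (g \<circ> coords B)"
    using integrable_determined[OF F AB(1)] integrable_determined[OF G AB(2)]
    by (simp_all add: o_def f g cong: Bochner_Integration.integrable_cong)
  have "expectation (\<lambda>\<omega>. F \<omega> * G \<omega>) = expectation (\<lambda>\<omega>. (f \<circ> coords A) \<omega> * (g \<circ> coords B) \<omega>)"
    by (intro Bochner_Integration.integral_cong) (auto simp: f g)
  also have "\<dots> = expectation (f \<circ> coords A) * expectation (g \<circ> coords B)"
    by (rule indep_var_lebesgue_integral[OF indep int])
  also have "expectation (f \<circ> coords A) = expectation F"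
    by (intro Bochner_Integration.integral_cong) (auto simp: f)
  also have "expectation (g \<circ> coords B) = expectation G"
    by (intro Bochner_Integration.integral_cong) (auto simp: g)
  finally show ?thesis .
qed

text \<open>Finitely many values turn the expectation into a finite sum with weights that do not
  depend on \<open>k\<close>. With \<open>k\<close> depending on a parameter, this allows termwise
  differentiation.\<close>

lemma expectation_image_determined:
  fixes k :: "'b \<Rightarrow> 'c :: {banach, second_countable_topology}"
  assumes F: "determined A F" and A: "A \<subseteq> I"
  shows "expectation (\<lambda>\<omega>. k (F \<omega>)) = (\<Sum>w\<in>F ` space M. prob (F -` {w} \<inter> space M) *\<^sub>R k w)"
proof -
  have fin: "finite (F ` space M)"
    using simple_functionD(1)[OF simple_function_determined[OF F A]] .
  have sets: "F -` {w} \<inter> space M \<in> sets M" for w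
    using simple_functionD(2)[OF simple_function_determined[OF F A]] .
  have "expectation (\<lambda>\<omega>. k (F \<omega>))
      = expectation (\<lambda>\<omega>. \<Sum>w\<in>F ` space M. indicator (F -` {w} \<inter> space M) \<omega> *\<^sub>R k w)"
  proof (intro Bochner_Integration.integral_cong refl)
    fix \<omega> assume \<omega>: "\<omega> \<in> space M"
    have "(\<Sum>w\<in>F ` space M. indicator (F -` {w} \<inter> space M) \<omega> *\<^sub>R k w)
        = (\<Sum>w\<in>F ` space M. if w = F \<omega> then k w else 0)"
      using \<omega> by (intro sum.cong) (auto simp: indicator_def)
    also have "\<dots> = k (F \<omega>)" using fin \<omega> by simp
    finally show "k (F \<omega>) = (\<Sum>w\<in>F ` space M. indicator (F -` {w} \<inter> space M) \<omega> *\<^sub>R k w)" ..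
  qed
  also have "\<dots> = (\<Sum>w\<in>F ` space M. expectation (\<lambda>\<omega>. indicator (F -` {w} \<inter> space M) \<omega> *\<^sub>R k w))"
    using sets by (intro Bochner_Integration.integral_sum) (simp add: integrable_scaleR_left emeasure_eq_measure)
  also have "\<dots> = (\<Sum>w\<in>F ` space M. prob (F -` {w} \<inter> space M) *\<^sub>R k w)"
    using sets by (intro sum.cong refl) (simp add: emeasure_eq_measure)
  finally show ?thesis .
qed

lemma abs_expectation_le:
  fixes F :: "'a \<Rightarrow> real"
  assumes "\<And>\<omega>. \<omega> \<in> space M \<Longrightarrow> \<bar>F \<omega>\<bar> \<le> C" "integrable M F"
  shows "\<bar>expectation F\<bar> \<le> C"
proof -
  have "\<bar>expectation F\<bar> \<le> expectation (\<lambda>\<omega>. \<bar>F \<omega>\<bar>)"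
    by (rule integral_abs_bound)
  also have "\<dots> \<le> C"
    using assms by (intro integral_le_const) auto
  finally show ?thesis .
qed

text \<open>After centring, terms with disjoint blocks have zero covariance and any other pair
  contributes at most \<open>(2 * C)\<^sup>2\<close>. It serves both for the exposure count and for
  the sum over neighbouring pairs in the central limit theorem.\<close>

lemma variance_sum_le:
  fixes F :: "nat \<Rightarrow> 'a \<Rightarrow> real"
  assumes K: "finite K" and det: "\<And>i. i \<in> K \<Longrightarrow> determined (E i) (F i)"
    and E: "\<And>i. i \<in> K \<Longrightarrow> E i \<subseteq> I"
    and bound: "\<And>i \<omega>. i \<in> K \<Longrightarrow> \<omega> \<in> space M \<Longrightarrow> \<bar>F i \<omega>\<bar> \<le> C"
    and m: "\<And>i. i \<in> K \<Longrightarrow> card {j \<in> K. E i \<inter> E j \<noteq> {}} \<le> m"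
  shows "variance (\<lambda>\<omega>. \<Sum>i\<in>K. F i \<omega>) \<le> real (card K) * real m * (4 * C\<^sup>2)"
proof -
  define G where "G i \<omega> = F i \<omega> - expectation (F i)" for i \<omega>
  have detG: "determined (E i) (G i)" if "i \<in> K" for i
    unfolding G_def using det[OF that] by (rule determined_comp)
  have int: "integrable M (F i)" if "i \<in> K" for i
    using det[OF that] E[OF that] by (rule integrable_determined)
  have G0: "expectation (G i) = 0" if "i \<in> K" for i
    unfolding G_def[abs_def] using int[OF that] by (simp add: prob_space)
  have G_bound: "\<bar>G i \<omega>\<bar> \<le> 2 * C" if "i \<in> K" "\<omega> \<in> space M" for i \<omega>
    using bound[OF that] abs_expectation_le[OF bound[OF that(1)] int[OF that(1)]]
    by (simp add: G_def)
  have detGG: "determined I (\<lambda>\<omega>. G i \<omega> * G j \<omega>)" if "i \<in> K" "j \<in> K" for i j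
    using that by (intro determined_comp2[where k=times] determined_mono[OF detG E])
  have intGG: "integrable M (\<lambda>\<omega>. G i \<omega> * G j \<omega>)" if "i \<in> K" "j \<in> K" for i j
    by (rule integrable_determined[OF detGG[OF that] order_refl])
  have "expectation (\<lambda>\<omega>. \<Sum>i\<in>K. F i \<omega>) = (\<Sum>i\<in>K. expectation (F i))"
    using int by (rule Bochner_Integration.integral_sum)
  then have "variance (\<lambda>\<omega>. \<Sum>i\<in>K. F i \<omega>) = expectation (\<lambda>\<omega>. (\<Sum>i\<in>K. G i \<omega>)\<^sup>2)"
    by (simp only: G_def sum_subtractf)
  also have "\<dots> = expectation (\<lambda>\<omega>. \<Sum>i\<in>K. \<Sum>j\<in>K. G i \<omega> * G j \<omega>)"
    by (simp only: power2_eq_square sum_product)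
  also have "\<dots> = (\<Sum>i\<in>K. expectation (\<lambda>\<omega>. \<Sum>j\<in>K. G i \<omega> * G j \<omega>))"
    using intGG by (intro Bochner_Integration.integral_sum Bochner_Integration.integrable_sum)
  also have "\<dots> = (\<Sum>i\<in>K. \<Sum>j\<in>K. expectation (\<lambda>\<omega>. G i \<omega> * G j \<omega>))"
    using intGG by (intro sum.cong refl Bochner_Integration.integral_sum)
  also have "\<dots> \<le> real (card K) * real m * (4 * C\<^sup>2)"
  proof (rule sum_dependent_pairs_bound[OF K _ _ _ m])
    fix i j assume ij: "i \<in> K" "j \<in> K"
    have "\<bar>G i \<omega> * G j \<omega>\<bar> \<le> 4 * C\<^sup>2" if "\<omega> \<in> space M" for \<omega>
      using mult_mono[OF G_bound[OF ij(1) that] G_bound[OF ij(2) that]] G_bound[OF ij(1) that]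
      by (simp add: abs_mult power2_eq_square)
    then show "expectation (\<lambda>\<omega>. G i \<omega> * G j \<omega>) \<le> 4 * C\<^sup>2"
      using abs_expectation_le[OF _ intGG[OF ij], of "4 * C\<^sup>2"] by (simp add: abs_le_iff)
    assume "\<not> E i \<inter> E j \<noteq> {}"
    then show "expectation (\<lambda>\<omega>. G i \<omega> * G j \<omega>) = 0"
      using expectation_mult_determined[OF detG detG E E] ij G0 by simp
  qed auto
  finally show ?thesis .
qed

end

section \<open>A central limit theorem for locally dependent sums\<close>

lemma card_UN_bounded:
  assumes "finite A" "\<And>x. x \<in> A \<Longrightarrow> card (F x) \<le> k"
  shows "card (\<Union>x\<in>A. F x) \<le> card A * k"
  using card_UN_le[OF assms(1), of F] sum_bounded_above[of A "\<lambda>x. card (F x)" k] assms(2)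
  by (metis of_nat_id order_trans)

text \<open>The Taylor bound in the shape that appears when \<open>iexp (t * total \<omega>)\<close>
  is factored out of its difference with the far part.\<close>

lemma norm_iexp_remainder: "cmod (1 - iexp (- x) - \<i> * x) \<le> x\<^sup>2 / 2"
proof -
  have "cmod (iexp (- x) - (\<Sum>k\<le>1. (\<i> * (- x)) ^ k / fact k)) \<le> \<bar>- x\<bar> ^ Suc 1 / fact (Suc 1)"
    by (rule iexp_approx1)
  moreover have "iexp (- x) - (\<Sum>k\<le>1. (\<i> * (- x)) ^ k / fact k) = - (1 - iexp (- x) - \<i> * x)"
    by simp
  ultimately have "cmod (1 - iexp (- x) - \<i> * x) \<le> \<bar>- x\<bar> ^ Suc 1 / fact (Suc 1)"
    by (metis norm_minus_cancel)
  then show ?thesis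
    by (simp add: power2_eq_square)
qed

locale locally_dependent_sum = independent_coordinates M I X
  for M :: "'a measure" and I :: "nat set" and X :: "nat \<Rightarrow> 'a \<Rightarrow> bool" +
  fixes K :: "nat set" and E :: "nat \<Rightarrow> nat set" and U :: "nat \<Rightarrow> 'a \<Rightarrow> real"
    and B :: real and d :: nat
  assumes finite_K: "finite K"
    and determined_U: "\<And>i. i \<in> K \<Longrightarrow> determined (E i) (U i)"
    and E_subset: "\<And>i. i \<in> K \<Longrightarrow> E i \<subseteq> I"
    and B_nonneg: "0 \<le> B"
    and U_bound: "\<And>i \<omega>. i \<in> K \<Longrightarrow> \<omega> \<in> space M \<Longrightarrow> \<bar>U i \<omega>\<bar> \<le> B"
    and U_mean: "\<And>i. i \<in> K \<Longrightarrow> expectation (U i) = 0"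
    and card_nbhd: "\<And>i. i \<in> K \<Longrightarrow> card {j \<in> K. E i \<inter> E j \<noteq> {}} \<le> d"
begin

section \<open>Splitting the sum into a near and a far part\<close>

definition nbhd :: "nat \<Rightarrow> nat set" where
  "nbhd i = {j \<in> K. E i \<inter> E j \<noteq> {}}"

definition total :: "'a \<Rightarrow> real" where
  "total \<omega> = (\<Sum>i\<in>K. U i \<omega>)"

definition near :: "nat \<Rightarrow> 'a \<Rightarrow> real" where
  "near i \<omega> = (\<Sum>j\<in>nbhd i. U j \<omega>)"

definition far :: "nat \<Rightarrow> 'a \<Rightarrow> real" where
  "far i \<omega> = (\<Sum>j\<in>K - nbhd i. U j \<omega>)"

text \<open>The part of the squared total that comes from dependent pairs. It has the same mean as
  the square, but unlike the square it concentrates around that mean.\<close>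

definition pairs :: "'a \<Rightarrow> real" where
  "pairs \<omega> = (\<Sum>i\<in>K. U i \<omega> * near i \<omega>)"

lemma nbhd_subset: "nbhd i \<subseteq> K"
  by (auto simp: nbhd_def)

lemma finite_nbhd: "finite (nbhd i)"
  using finite_K by (auto simp: nbhd_def)

lemma total_split: "total \<omega> = near i \<omega> + far i \<omega>"
  unfolding total_def near_def far_def
  using sum.subset_diff[OF nbhd_subset finite_K] by (simp add: add.commute)

lemma determined_U_I: "i \<in> K \<Longrightarrow> determined I (U i)"
  using determined_U E_subset by (rule determined_mono)

lemma determined_total: "determined I total"
  unfolding total_def by (intro determined_sum determined_U_I)

lemma determined_near: "determined (\<Union>j\<in>nbhd i. E j) (near i)"
  unfolding near_def using nbhd_subset
  by (intro determined_sum determined_mono[OF determined_U]) auto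

lemma determined_far: "determined (\<Union>j\<in>K - nbhd i. E j) (far i)"
  unfolding far_def by (intro determined_sum determined_mono[OF determined_U]) auto

lemma near_subset: "(\<Union>j\<in>nbhd i. E j) \<subseteq> I"
  using nbhd_subset E_subset by blast

lemma far_subset: "(\<Union>j\<in>K - nbhd i. E j) \<subseteq> I"
  using E_subset by blast

lemma far_disjoint: "i \<in> K \<Longrightarrow> E i \<inter> (\<Union>j\<in>K - nbhd i. E j) = {}"
  by (auto simp: nbhd_def)

lemma near_bound: "i \<in> K \<Longrightarrow> \<omega> \<in> space M \<Longrightarrow> \<bar>near i \<omega>\<bar> \<le> real d * B"
proof -
  assume i: "i \<in> K" and \<omega>: "\<omega> \<in> space M"
  have "\<bar>near i \<omega>\<bar> \<le> (\<Sum>j\<in>nbhd i. \<bar>U j \<omega>\<bar>)"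
    unfolding near_def by (rule sum_abs)
  also have "\<dots> \<le> real (card (nbhd i)) * B"
    using U_bound[OF _ \<omega>] nbhd_subset by (intro sum_bounded_above) auto
  also have "\<dots> \<le> real d * B"
    using card_nbhd[OF i] B_nonneg by (intro mult_right_mono) (auto simp: nbhd_def)
  finally show ?thesis .
qed

lemma determined_pair: "i \<in> K \<Longrightarrow> determined (\<Union>j\<in>nbhd i. E j) (\<lambda>\<omega>. U i \<omega> * near i \<omega>)"
proof (intro determined_comp2[where k=times] determined_near)
  assume i: "i \<in> K"
  show "determined (\<Union>j\<in>nbhd i. E j) (U i)"
  \<comment> \<open>With an empty block, \<open>i\<close> is not a member of its own neighbourhood;
    but then \<open>U i\<close> is constant on the space and determined by any set.\<close>
  proof (cases "E i = {}")
    case True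
    then show ?thesis using determined_U[OF i] by (auto intro: determined_mono)
  next
    case False
    with i show ?thesis by (intro determined_mono[OF determined_U[OF i]]) (auto simp: nbhd_def)
  qed
qed

lemma determined_pairs: "determined I pairs"
  unfolding pairs_def by (intro determined_sum determined_mono[OF determined_pair near_subset])

text \<open>If the blocks of the products at \<open>i\<close> and \<open>k\<close> meet, there are
  \<open>j\<close> and \<open>l\<close> such that consecutive blocks along i, j, l, k meet. So
  \<open>k\<close> is reached from \<open>i\<close> in three steps with at most \<open>d\<close>
  choices each.\<close>

lemma card_second_nbhd:
  assumes i: "i \<in> K"
  shows "card {k \<in> K. (\<Union>j\<in>nbhd i. E j) \<inter> (\<Union>j\<in>nbhd k. E j) \<noteq> {}} \<le> d ^ 3"
proof -
  have le: "card (nbhd j) \<le> d" if "j \<in> K" for j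
    using card_nbhd[OF that] by (simp add: nbhd_def)
  have sub: "{k \<in> K. (\<Union>j\<in>nbhd i. E j) \<inter> (\<Union>j\<in>nbhd k. E j) \<noteq> {}}
      \<subseteq> (\<Union>j\<in>nbhd i. \<Union>l\<in>nbhd j. nbhd l)"
    by (fastforce simp: nbhd_def)
  have two: "card (\<Union>l\<in>nbhd j. nbhd l) \<le> d * d" if "j \<in> K" for j
    using card_UN_bounded[OF finite_nbhd, of j nbhd d] le[OF that] le nbhd_subset
    by (meson mult_le_mono1 order_trans subsetD)
  have "card {k \<in> K. (\<Union>j\<in>nbhd i. E j) \<inter> (\<Union>j\<in>nbhd k. E j) \<noteq> {}}
      \<le> card (\<Union>j\<in>nbhd i. \<Union>l\<in>nbhd j. nbhd l)"
    using sub by (intro card_mono) (auto simp: finite_nbhd)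
  also have "\<dots> \<le> card (nbhd i) * (d * d)"
    using two nbhd_subset by (intro card_UN_bounded finite_nbhd) auto
  also have "\<dots> \<le> d * (d * d)"
    using le[OF i] by (rule mult_le_mono1)
  finally show ?thesis by (simp add: power3_eq_cube)
qed

lemma variance_pairs_le: "variance pairs \<le> real (card K) * real (d ^ 3) * (4 * (real d * B\<^sup>2)\<^sup>2)"
  unfolding pairs_def[abs_def]
proof (rule variance_sum_le[OF finite_K determined_pair near_subset _ card_second_nbhd])
  fix i \<omega> assume "i \<in> K" "\<omega> \<in> space M"
  then show "\<bar>U i \<omega> * near i \<omega>\<bar> \<le> real d * B\<^sup>2"
    using mult_mono[OF U_bound near_bound B_nonneg, of i \<omega> i \<omega>]
    by (simp add: abs_mult power2_eq_square mult_ac)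
qed

text \<open>Allows a multiple of \<open>U i\<close> by any function of the far part to be subtracted
  at no cost, so that only the effect of the near part on the exponential remains.\<close>

lemma expectation_U_far:
  fixes k :: "real \<Rightarrow> complex"
  assumes "i \<in> K"
  shows "expectation (\<lambda>\<omega>. complex_of_real (U i \<omega>) * k (far i \<omega>)) = 0"
proof -
  have "expectation (\<lambda>\<omega>. complex_of_real (U i \<omega>) * k (far i \<omega>))
      = expectation (\<lambda>\<omega>. complex_of_real (U i \<omega>)) * expectation (\<lambda>\<omega>. k (far i \<omega>))"
    by (rule expectation_mult_determined[OF determined_comp[OF determined_U, where k=complex_of_real]
          determined_comp[OF determined_far, where k=k] E_subset far_subset far_disjoint, OF assms assms assms])
  then show ?thesis using U_mean[OF assms] by simp
qed

text \<open>Writing the total as near plus far next to each factor \<open>U i\<close>, the far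
  products vanish in expectation.\<close>

lemma expectation_pairs: "expectation pairs = expectation (\<lambda>\<omega>. (total \<omega>)\<^sup>2)"
proof -
  have int1: "integrable M (\<lambda>\<omega>. U i \<omega> * near i \<omega>)" if "i \<in> K" for i
    using determined_pair[OF that] near_subset by (rule integrable_determined)
  have int2: "integrable M (\<lambda>\<omega>. U i \<omega> * far i \<omega>)" if "i \<in> K" for i
    using that
    by (intro integrable_determined[of I] determined_comp2[where k=times] determined_U_I
        determined_mono[OF determined_far far_subset] order_refl)
  have zero: "expectation (\<lambda>\<omega>. U i \<omega> * far i \<omega>) = 0" if "i \<in> K" for i
    using expectation_mult_determined[OF determined_U determined_far E_subset far_subset far_disjoint]
      U_mean that by simp
  have "expectation (\<lambda>\<omega>. (total \<omega>)\<^sup>2)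
      = expectation (\<lambda>\<omega>. \<Sum>i\<in>K. U i \<omega> * near i \<omega> + U i \<omega> * far i \<omega>)"
  proof (intro Bochner_Integration.integral_cong refl)
    fix \<omega>
    have "(total \<omega>)\<^sup>2 = (\<Sum>i\<in>K. U i \<omega> * total \<omega>)"
      unfolding power2_eq_square by (subst total_def) (rule sum_distrib_right)
    also have "\<dots> = (\<Sum>i\<in>K. U i \<omega> * near i \<omega> + U i \<omega> * far i \<omega>)"
      by (intro sum.cong refl, subst total_split) (rule distrib_left)
    finally show "(total \<omega>)\<^sup>2 = (\<Sum>i\<in>K. U i \<omega> * near i \<omega> + U i \<omega> * far i \<omega>)" .
  qed
  also have "\<dots> = (\<Sum>i\<in>K. expectation (\<lambda>\<omega>. U i \<omega> * near i \<omega> + U i \<omega> * far i \<omega>))"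
    using int1 int2 by (intro Bochner_Integration.integral_sum Bochner_Integration.integrable_add)
  also have "\<dots> = (\<Sum>i\<in>K. expectation (\<lambda>\<omega>. U i \<omega> * near i \<omega>))"
    using int1 int2 zero by (intro sum.cong refl) simp
  also have "\<dots> = expectation pairs"
    unfolding pairs_def using int1 by (intro Bochner_Integration.integral_sum[symmetric])
  finally show ?thesis ..
qed

section \<open>The characteristic function of the sum\<close>

definition phi :: "real \<Rightarrow> complex" where
  "phi t = expectation (\<lambda>\<omega>. iexp (t * total \<omega>))"

definition phi' :: "real \<Rightarrow> complex" where
  "phi' t = expectation (\<lambda>\<omega>. \<i> * total \<omega> * iexp (t * total \<omega>))"

text \<open>As \<open>total\<close> takes finitely many values, \<open>phi\<close> is a finite
  combination of exponentials, and no theorem on differentiation under the integral is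
  involved.\<close>

lemma has_vector_derivative_phi: "(phi has_vector_derivative phi' t) (at t within A)"
proof -
  have eq: "phi = (\<lambda>s. \<Sum>w\<in>total ` space M. prob (total -` {w} \<inter> space M) *\<^sub>R iexp (s * w))"
    unfolding phi_def by (intro ext expectation_image_determined[OF determined_total order_refl, of "\<lambda>w. iexp (_ * w)"])
  have eq': "phi' t = (\<Sum>w\<in>total ` space M. prob (total -` {w} \<inter> space M) *\<^sub>R (\<i> * w * iexp (t * w)))"
    unfolding phi'_def
    by (intro expectation_image_determined[OF determined_total order_refl, of "\<lambda>w. \<i> * w * iexp (t * w)"])
  have "((\<lambda>s. iexp (s * w)) has_vector_derivative \<i> * w * iexp (t * w)) (at t within A)" for w
    using exp_scaleR_has_vector_derivative_right[of "\<i> * complex_of_real w" t A]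
    by (simp add: scaleR_conv_of_real mult_ac)
  then show ?thesis
    unfolding eq eq' by (intro has_vector_derivative_sum bounded_linear.has_vector_derivative[OF bounded_linear_scaleR_right])
qed

text \<open>The first term is one second-order Taylor remainder per summand, with the near part
  bounded by \<open>real d * B\<close>; the second is \<open>\<bar>t\<bar>\<close> times the bound
  on the standard deviation of \<open>pairs\<close>.\<close>

definition clt_error :: "real \<Rightarrow> real" where
  "clt_error t = real (card K) * (B * (t * (real d * B))\<^sup>2 / 2)
    + \<bar>t\<bar> * sqrt (real (card K) * real (d ^ 3) * (4 * (real d * B\<^sup>2)\<^sup>2))"

text \<open>The characteristic function almost satisfies the differential equation
  \<open>\<phi>' = - t \<phi>\<close> of the standard normal one: expanding \<open>1 - exp (- \<i> t S\<^sub>i)\<close> to first order,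
  where \<open>S\<^sub>i\<close> is the part of the sum near \<open>i\<close>, reduces \<open>\<phi>'\<close> to the sum over neighbouring
  pairs, which concentrates around its mean \<open>1\<close>.\<close>

lemma phi_ode:
  assumes unit_var: "expectation (\<lambda>\<omega>. (total \<omega>)\<^sup>2) = 1"
  shows "cmod (phi' t + t * phi t) \<le> clt_error t"
proof -
  let ?e = "\<lambda>\<omega>. iexp (t * total \<omega>)"
  have det_e: "determined I ?e"
    by (rule determined_comp[OF determined_total, where k="\<lambda>w. iexp (t * w)"])
  have intU: "integrable M (\<lambda>\<omega>. U i \<omega> * ?e \<omega>)" if "i \<in> K" for i
    using that by (intro integrable_determined[of I] determined_comp2[where k="\<lambda>x y. complex_of_real x * y"]
        determined_U_I det_e order_refl)
  have intUn: "integrable M (\<lambda>\<omega>. complex_of_real (U i \<omega> * near i \<omega>) * ?e \<omega>)" if "i \<in> K" for i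
    using that by (intro integrable_determined[of I] determined_comp2[where k="\<lambda>x y. complex_of_real x * y"]
        determined_mono[OF determined_pair near_subset] det_e order_refl)
  have intf: "integrable M (\<lambda>\<omega>. U i \<omega> * iexp (t * far i \<omega>))" if "i \<in> K" for i
    using that by (intro integrable_determined[of I] determined_comp2[where k="\<lambda>x y. complex_of_real x * iexp (t * y)"]
        determined_mono[OF determined_far far_subset] determined_U_I order_refl)
  \<comment> \<open>Because the expectation of \<open>U i\<close> times
    \<open>iexp (t * far i \<omega>)\<close> is 0, \<open>R i\<close> is the expectation of
    \<open>U i\<close> times a pure second-order remainder in
    \<open>t * near i \<omega>\<close>.\<close>
  define R where "R i = expectation (\<lambda>\<omega>. U i \<omega> * ?e \<omega>)
    - \<i> * t * expectation (\<lambda>\<omega>. complex_of_real (U i \<omega> * near i \<omega>) * ?e \<omega>)" for i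
  have R: "cmod (R i) \<le> B * (t * (real d * B))\<^sup>2 / 2" if i: "i \<in> K" for i
  proof -
    define r where "r \<omega> = U i \<omega> * ?e \<omega> - U i \<omega> * iexp (t * far i \<omega>)
      - \<i> * t * (complex_of_real (U i \<omega> * near i \<omega>) * ?e \<omega>)" for \<omega>
    have int_r: "integrable M r"
      unfolding r_def using intU[OF i] intUn[OF i] intf[OF i]
      by (intro Bochner_Integration.integrable_diff integrable_mult_right) auto
    have "R i = expectation r"
      unfolding r_def R_def using intU[OF i] intUn[OF i] intf[OF i] expectation_U_far[OF i, of "\<lambda>y. iexp (t * y)"]
      by simp
    moreover have "cmod (expectation r) \<le> expectation (\<lambda>\<omega>. cmod (r \<omega>))"
      by (rule integral_norm_bound)
    moreover have "expectation (\<lambda>\<omega>. cmod (r \<omega>)) \<le> B * (t * (real d * B))\<^sup>2 / 2"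
    proof (rule integral_le_const)
      show "AE \<omega> in M. cmod (r \<omega>) \<le> B * (t * (real d * B))\<^sup>2 / 2"
      proof (rule AE_I2)
        fix \<omega> assume \<omega>: "\<omega> \<in> space M"
        have "iexp (t * far i \<omega>) = ?e \<omega> * iexp (- (t * near i \<omega>))"
          by (simp add: total_split[of \<omega> i] algebra_simps flip: exp_add)
        then have "r \<omega> = U i \<omega> * (?e \<omega> * (1 - iexp (- (t * near i \<omega>)) - \<i> * complex_of_real (t * near i \<omega>)))"
          unfolding r_def by (simp add: algebra_simps)
        then have "cmod (r \<omega>) = \<bar>U i \<omega>\<bar> * cmod (1 - iexp (- (t * near i \<omega>)) - \<i> * complex_of_real (t * near i \<omega>))"
          by (simp only: norm_mult norm_of_real norm_exp_i_times mult_1_left)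
        also have "\<dots> \<le> B * ((t * near i \<omega>)\<^sup>2 / 2)"
          using U_bound[OF i \<omega>] B_nonneg by (intro mult_mono norm_iexp_remainder) auto
        also have "\<dots> \<le> B * ((t * (real d * B))\<^sup>2 / 2)"
        proof -
          have "(near i \<omega>)\<^sup>2 \<le> (real d * B)\<^sup>2"
            using near_bound[OF i \<omega>] B_nonneg by (simp add: abs_le_square_iff[symmetric] abs_mult)
          then show ?thesis
            using B_nonneg by (intro mult_left_mono divide_right_mono) (auto simp: power_mult_distrib mult_left_mono)
        qed
        finally show "cmod (r \<omega>) \<le> B * (t * (real d * B))\<^sup>2 / 2" by simp
      qed
    qed (use int_r in auto)
    ultimately show ?thesis by (metis order_trans)
  qed
  define Q where "Q = expectation (\<lambda>\<omega>. complex_of_real (pairs \<omega> - 1) * ?e \<omega>)"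
  have int_e: "integrable M ?e"
    using det_e by (rule integrable_determined) simp
  have int_pe: "integrable M (\<lambda>\<omega>. complex_of_real (pairs \<omega>) * ?e \<omega>)"
    by (intro integrable_determined[of I] determined_comp2[where k="\<lambda>x y. complex_of_real x * y"]
        determined_pairs det_e order_refl)
  have int_abs: "integrable M (\<lambda>\<omega>. \<bar>pairs \<omega> - 1\<bar>)" and int_sq: "integrable M (\<lambda>\<omega>. \<bar>pairs \<omega> - 1\<bar>\<^sup>2)"
    using integrable_determined[OF determined_comp[OF determined_pairs, where k="\<lambda>x. \<bar>x - 1\<bar>"] order_refl]
      integrable_determined[OF determined_comp[OF determined_pairs, where k="\<lambda>x. \<bar>x - 1\<bar>\<^sup>2"] order_refl] .
  have Q: "cmod Q \<le> sqrt (real (card K) * real (d ^ 3) * (4 * (real d * B\<^sup>2)\<^sup>2))"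
  proof -
    have "cmod Q \<le> expectation (\<lambda>\<omega>. cmod (complex_of_real (pairs \<omega> - 1) * ?e \<omega>))"
      unfolding Q_def by (rule integral_norm_bound)
    also have "\<dots> = expectation (\<lambda>\<omega>. \<bar>pairs \<omega> - 1\<bar>)"
      by (simp only: norm_mult norm_of_real norm_exp_i_times mult_1_right)
    \<comment> \<open>Cauchy-Schwarz, read off from the nonnegative variance of
      \<open>\<bar>pairs \<omega> - 1\<bar>\<close>.\<close>
    also have "\<dots> \<le> sqrt (expectation (\<lambda>\<omega>. \<bar>pairs \<omega> - 1\<bar>\<^sup>2))"
      using variance_positive[of "\<lambda>\<omega>. \<bar>pairs \<omega> - 1\<bar>"] variance_eq[OF int_abs int_sq]
      by (intro real_le_rsqrt) simp
    \<comment> \<open>The mean of \<open>pairs\<close> is the second moment of \<open>total\<close>,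
      which is 1, so the second moment of \<open>pairs \<omega> - 1\<close> is a variance.\<close>
    also have "\<dots> = sqrt (variance pairs)"
      using expectation_pairs unit_var by simp
    also have "\<dots> \<le> sqrt (real (card K) * real (d ^ 3) * (4 * (real d * B\<^sup>2)\<^sup>2))"
      using variance_pairs_le by (rule real_sqrt_le_mono)
    finally show ?thesis .
  qed
  have "phi' t = \<i> * expectation (\<lambda>\<omega>. \<Sum>i\<in>K. U i \<omega> * ?e \<omega>)"
    unfolding phi'_def by (simp add: total_def sum_distrib_right mult.assoc flip: integral_mult_right_zero)
  also have "\<dots> = \<i> * (\<Sum>i\<in>K. R i + \<i> * t * expectation (\<lambda>\<omega>. complex_of_real (U i \<omega> * near i \<omega>) * ?e \<omega>))"
    by (subst Bochner_Integration.integral_sum[OF intU]) (simp_all add: R_def)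
  also have "\<dots> = \<i> * ((\<Sum>i\<in>K. R i) + \<i> * t * (\<Sum>i\<in>K. expectation (\<lambda>\<omega>. complex_of_real (U i \<omega> * near i \<omega>) * ?e \<omega>)))"
    by (simp only: sum.distrib sum_distrib_left[symmetric])
  also have "\<dots> = \<i> * (\<Sum>i\<in>K. R i) - t * (\<Sum>i\<in>K. expectation (\<lambda>\<omega>. complex_of_real (U i \<omega> * near i \<omega>) * ?e \<omega>))"
    by (simp add: distrib_left mult.assoc)
  also have "(\<Sum>i\<in>K. expectation (\<lambda>\<omega>. complex_of_real (U i \<omega> * near i \<omega>) * ?e \<omega>))
      = expectation (\<lambda>\<omega>. complex_of_real (pairs \<omega>) * ?e \<omega>)"
    by (subst Bochner_Integration.integral_sum[OF intUn, symmetric]) (simp_all add: pairs_def sum_distrib_right)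
  also have "\<dots> = Q + phi t"
    unfolding Q_def phi_def using int_e int_pe by (simp add: left_diff_distrib)
  finally have "phi' t + t * phi t = \<i> * (\<Sum>i\<in>K. R i) - t * Q"
    by (simp add: algebra_simps)
  then have "cmod (phi' t + t * phi t) \<le> cmod (\<Sum>i\<in>K. R i) + \<bar>t\<bar> * cmod Q"
    using norm_triangle_ineq4[of "\<i> * (\<Sum>i\<in>K. R i)" "t * Q"] by (simp add: norm_mult)
  also have "\<dots> \<le> clt_error t"
    unfolding clt_error_def using R Q by (intro add_mono mult_left_mono sum_norm_bound) auto
  finally show ?thesis .
qed

text \<open>Makes the bound at the end point \<open>t\<close> valid along the whole segment from 0
  to \<open>t\<close>.\<close>

lemma clt_error_mono: "\<bar>s\<bar> \<le> \<bar>t\<bar> \<Longrightarrow> clt_error s \<le> clt_error t"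
proof -
  assume st: "\<bar>s\<bar> \<le> \<bar>t\<bar>"
  then have "s\<^sup>2 \<le> t\<^sup>2" by (simp add: abs_le_square_iff)
  then have "(s * (real d * B))\<^sup>2 \<le> (t * (real d * B))\<^sup>2"
    unfolding power_mult_distrib by (rule mult_right_mono) simp
  with st show ?thesis
    unfolding clt_error_def using B_nonneg
    by (intro add_mono mult_left_mono mult_right_mono divide_right_mono) auto
qed

text \<open>With the integrating factor \<open>exp (s\<^sup>2 / 2)\<close>, the defect in the
  differential equation becomes the derivative of \<open>psi\<close>, and \<open>psi 0 = 1\<close>.
  The mean value inequality bounds \<open>psi t - 1\<close>; the factor
  \<open>exp (t\<^sup>2 / 2)\<close> then occurs on both sides and cancels.\<close>

lemma phi_approx:
  assumes unit_var: "expectation (\<lambda>\<omega>. (total \<omega>)\<^sup>2) = 1"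
  shows "cmod (phi t - exp (- (t\<^sup>2) / 2)) \<le> \<bar>t\<bar> * clt_error t"
proof -
  define psi where "psi s = exp (s\<^sup>2 / 2) *\<^sub>R phi s" for s :: real
  have deriv: "(psi has_vector_derivative exp (s\<^sup>2 / 2) *\<^sub>R (phi' s + s * phi s)) (at s within A)" for s A
  proof -
    have "((\<lambda>s. exp (s\<^sup>2 / 2)) has_real_derivative s * exp (s\<^sup>2 / 2)) (at s within A)"
      by (auto intro!: derivative_eq_intros)
    from has_vector_derivative_scaleR[OF this has_vector_derivative_phi]
    show ?thesis unfolding psi_def by (simp add: scaleR_conv_of_real algebra_simps)
  qed
  let ?S = "closed_segment 0 t"
  have bound: "norm (exp (s\<^sup>2 / 2) *\<^sub>R (phi' s + s * phi s)) \<le> exp (t\<^sup>2 / 2) * clt_error t" if "s \<in> ?S" for s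
  proof -
    have s: "\<bar>s\<bar> \<le> \<bar>t\<bar>"
      using that by (auto simp: closed_segment_eq_real_ivl split: if_splits)
    have "exp (s\<^sup>2 / 2) * cmod (phi' s + s * phi s) \<le> exp (t\<^sup>2 / 2) * clt_error t"
      using s order_trans[OF phi_ode[OF unit_var] clt_error_mono[OF s]]
      by (intro mult_mono) (auto simp: abs_le_square_iff)
    then show ?thesis by simp
  qed
  have "norm (psi t - psi 0) \<le> exp (t\<^sup>2 / 2) * clt_error t * norm (t - 0)"
  proof (rule differentiable_bound[of ?S psi "\<lambda>s h. h *\<^sub>R (exp (s\<^sup>2 / 2) *\<^sub>R (phi' s + s * phi s))"])
    show "(psi has_derivative (\<lambda>h. h *\<^sub>R (exp (s\<^sup>2 / 2) *\<^sub>R (phi' s + s * phi s)))) (at s within ?S)" for s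
      using deriv[of s ?S] by (simp add: has_vector_derivative_def)
    show "onorm (\<lambda>h. h *\<^sub>R (exp (s\<^sup>2 / 2) *\<^sub>R (phi' s + s * phi s))) \<le> exp (t\<^sup>2 / 2) * clt_error t" if "s \<in> ?S" for s
    proof (rule onorm_le)
      fix h :: real
      show "norm (h *\<^sub>R (exp (s\<^sup>2 / 2) *\<^sub>R (phi' s + s * phi s))) \<le> exp (t\<^sup>2 / 2) * clt_error t * norm h"
        unfolding norm_scaleR[of h] real_norm_def mult.commute[of "\<bar>h\<bar>"]
        using bound[OF that] by (rule mult_right_mono) simp
    qed
  qed auto
  moreover have "psi 0 = 1"
    by (simp add: psi_def phi_def prob_space)
  moreover have "psi t - 1 = exp (t\<^sup>2 / 2) *\<^sub>R (phi t - exp (- (t\<^sup>2) / 2))"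
    by (simp add: psi_def scaleR_conv_of_real algebra_simps exp_minus flip: exp_of_real exp_add)
  ultimately have "exp (t\<^sup>2 / 2) * cmod (phi t - exp (- (t\<^sup>2) / 2)) \<le> exp (t\<^sup>2 / 2) * (\<bar>t\<bar> * clt_error t)"
    by (simp add: mult_ac)
  then show ?thesis by simp
qed

end

text \<open>For fixed \<open>t\<close> and \<open>d\<close> the error is a multiple of
  \<open>card K * B ^ 3\<close> plus a multiple of the square root of \<open>card K * B ^ 4\<close>,
  which explains \<open>B3\<close> and \<open>B4\<close>. The hypothesis \<open>distr\<close> covers
  every \<open>n\<close> because Levy's continuity theorem asks for real distributions
  throughout.\<close>

lemma weak_conv_locally_dependent_sum:
  fixes M :: "nat \<Rightarrow> 'a measure"
  assumes distr: "\<And>n. real_distribution (distr (M n) borel (\<lambda>\<omega>. \<Sum>i\<in>K n. U n i \<omega>))"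
    and rv: "\<And>n. (\<lambda>\<omega>. \<Sum>i\<in>K n. U n i \<omega>) \<in> borel_measurable (M n)"
    and sum: "\<forall>\<^sub>F n in sequentially. locally_dependent_sum (M n) (I n) (X n) (K n) (E n) (U n) (B n) d"
    and unit_var: "\<forall>\<^sub>F n in sequentially. (\<integral>\<omega>. (\<Sum>i\<in>K n. U n i \<omega>)\<^sup>2 \<partial>M n) = 1"
    and B3: "(\<lambda>n. real (card (K n)) * B n ^ 3) \<longlonglongrightarrow> 0"
    and B4: "(\<lambda>n. real (card (K n)) * B n ^ 4) \<longlonglongrightarrow> 0"
  shows "weak_conv_m (\<lambda>n. distr (M n) borel (\<lambda>\<omega>. \<Sum>i\<in>K n. U n i \<omega>)) std_normal_distribution"
proof (rule levy_continuity[OF distr real_dist_normal_dist])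
  fix t :: real
  let ?err = "\<lambda>n. \<bar>t\<bar> * ((t\<^sup>2 * (real d)\<^sup>2 / 2) * (real (card (K n)) * B n ^ 3)
      + \<bar>t\<bar> * sqrt ((4 * real d ^ 5) * (real (card (K n)) * B n ^ 4)))"
  have "?err \<longlonglongrightarrow> \<bar>t\<bar> * ((t\<^sup>2 * (real d)\<^sup>2 / 2) * 0 + \<bar>t\<bar> * sqrt ((4 * real d ^ 5) * 0))"
    by (intro tendsto_intros B3 B4)
  then have lim: "?err \<longlonglongrightarrow> 0" by simp
  have "\<forall>\<^sub>F n in sequentially. cmod (char (distr (M n) borel (\<lambda>\<omega>. \<Sum>i\<in>K n. U n i \<omega>)) t
      - complex_of_real (exp (- (t\<^sup>2) / 2))) \<le> ?err n"
    using sum unit_var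
  proof eventually_elim
    case (elim n)
    interpret locally_dependent_sum "M n" "I n" "X n" "K n" "E n" "U n" "B n" d
      by (rule elim(1))
    have "char (distr (M n) borel (\<lambda>\<omega>. \<Sum>i\<in>K n. U n i \<omega>)) t = phi t"
      unfolding char_def phi_def total_def using rv[of n] by (subst integral_distr) auto
    moreover have "\<bar>t\<bar> * clt_error t = ?err n"
      by (simp add: clt_error_def power_mult_distrib mult_ac power2_eq_square power3_eq_cube
          numeral_eq_Suc)
    moreover have "cmod (phi t - complex_of_real (exp (- (t\<^sup>2) / 2))) \<le> \<bar>t\<bar> * clt_error t"
      using phi_approx elim(2) unfolding total_def by (simp add: exp_of_real)
    ultimately show ?case by (simp only:)
  qed
  then have "(\<lambda>n. char (distr (M n) borel (\<lambda>\<omega>. \<Sum>i\<in>K n. U n i \<omega>)) t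
      - complex_of_real (exp (- (t\<^sup>2) / 2))) \<longlonglongrightarrow> 0"
    by (rule Lim_null_comparison[OF _ lim])
  then show "(\<lambda>n. char (distr (M n) borel (\<lambda>\<omega>. \<Sum>i\<in>K n. U n i \<omega>)) t) \<longlonglongrightarrow> char std_normal_distribution t"
    unfolding char_std_normal_distribution by (rule LIM_zero_cancel)
qed

section \<open>Contrasts of exposure groups\<close>

lemma unit_mean_bounds: "0 \<le> unit_mean N xi" "unit_mean N xi \<le> 1"
proof -
  have "(\<Sum>i<N. of_bool (xi i) :: real) \<le> (\<Sum>i<N. 1)"
    by (intro sum_mono) auto
  then show "unit_mean N xi \<le> 1"
    by (cases "N = 0") (auto simp: unit_mean_def field_simps)
  show "0 \<le> unit_mean N xi"
    unfolding unit_mean_def by (intro mult_nonneg_nonneg sum_nonneg) auto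
qed

lemma sum_deviation: "(\<Sum>i<N. of_bool (xi i) - unit_mean N xi) = 0"
  by (cases "N = 0") (auto simp: sum_subtractf unit_mean_def)

text \<open>A binary population with mean \<open>m\<close> has variance m(1 - m), at most 1/4. This
  is the origin of the factor 2 in the denominator of the interval width.\<close>

lemma sum_sq_deviation: "(\<Sum>i<N. (of_bool (xi i) - unit_mean N xi)\<^sup>2) \<le> real N / 4"
proof (cases "N = 0")
  case False
  define m where "m = unit_mean N xi"
  define S :: real where "S = (\<Sum>i<N. of_bool (xi i))"
  have S: "S = real N * m"
    using False by (simp add: S_def m_def unit_mean_def)
  have "(\<Sum>i<N. (of_bool (xi i) - m)\<^sup>2) = (\<Sum>i<N. (1 - 2 * m) * of_bool (xi i) + m\<^sup>2)"
    by (intro sum.cong) (auto simp: power2_eq_square algebra_simps)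
  also have "\<dots> = (1 - 2 * m) * S + real N * m\<^sup>2"
    by (simp add: sum.distrib S_def sum_distrib_left)
  also have "\<dots> = real N * (1 / 4 - (m - 1 / 2)\<^sup>2)"
    unfolding S by (simp add: power2_eq_square algebra_simps)
  also have "\<dots> \<le> real N * (1 / 4)"
    by (intro mult_left_mono) auto
  finally show ?thesis by (simp add: m_def)
qed simp

text \<open>With \<open>A\<close> the exposed total and \<open>S\<close> the overall total, both
  sides equal (N A - S L) / (L (N - L)). The hypotheses exclude an empty group, where
  \<open>contrast\<close> takes a default value.\<close>

lemma contrast_eq:
  assumes "0 < exposure_count N z" "exposure_count N z < real N"
  shows "contrast N xi z
    = real N * T_stat N z xi / (exposure_count N z * (real N - exposure_count N z))"
proof -
  define A S :: real where "A = (\<Sum>i<N. of_bool (xi i) * of_bool (z i))" and "S = (\<Sum>i<N. of_bool (xi i))"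
  define L where "L = exposure_count N z"
  have 1: "(\<Sum>i \<in> {i. i < N \<and> z i}. of_bool (xi i)) = A"
    unfolding A_def by (intro sum.mono_neutral_cong_left) auto
  have "(\<Sum>i \<in> {i. i < N \<and> \<not> z i}. of_bool (xi i)) = (\<Sum>i<N. of_bool (xi i) - of_bool (xi i) * of_bool (z i) :: real)"
    by (intro sum.mono_neutral_cong_left) auto
  then have 2: "(\<Sum>i \<in> {i. i < N \<and> \<not> z i}. of_bool (xi i)) = S - A"
    by (simp add: sum_subtractf S_def A_def)
  have T: "T_stat N z xi = A - S / real N * L"
  proof -
    have "unit_mean N xi = S / real N" by (simp only: unit_mean_def S_def mult_1_left times_divide_eq_left)
    then show ?thesis
      by (simp only: T_stat_def A_def L_def exposure_count_def left_diff_distrib sum_subtractf sum_distrib_left)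
  qed
  have "L > 0" "real N - L > 0" "real N > 0"
    using assms by (auto simp: L_def)
  then show ?thesis
    unfolding contrast_def 1 2 T L_def[symmetric] by (simp add: field_simps)
qed

section \<open>A single design of fixed size: moments and the variance bound\<close>

locale exposure_design = independent_coordinates M "{..<N}" X
  for M :: "'a measure" and N :: nat and X :: "nat \<Rightarrow> 'a \<Rightarrow> bool" +
  fixes Z :: "nat \<Rightarrow> 'a \<Rightarrow> bool" and eta :: "nat \<Rightarrow> nat set" and xi :: "nat \<Rightarrow> bool"
    and p c :: real and d :: nat
  assumes determined_Z: "\<And>i. i < N \<Longrightarrow> determined (eta i) (Z i)"
    and eta_subset: "\<And>i. i < N \<Longrightarrow> eta i \<subseteq> {..<N}"
    and degree: "\<And>i. i < N \<Longrightarrow> card {j \<in> {..<N}. eta i \<inter> eta j \<noteq> {}} \<le> d"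
    and prob_Z: "\<And>i. i < N \<Longrightarrow> prob {\<omega> \<in> space M. Z i \<omega>} = p"
    and N_pos: "0 < N" and c_pos: "0 < c"
    and variance_ge: "c * real N \<le> variance (\<lambda>\<omega>. T_stat N (\<lambda>i. Z i \<omega>) xi)"
begin

definition v :: "nat \<Rightarrow> real" where
  "v i = of_bool (xi i) - unit_mean N xi"

definition T :: "'a \<Rightarrow> real" where
  "T \<omega> = T_stat N (\<lambda>i. Z i \<omega>) xi"

definition sd :: real where
  "sd = sqrt (variance T)"

definition L :: "'a \<Rightarrow> real" where
  "L \<omega> = exposure_count N (\<lambda>i. Z i \<omega>)"

lemma sum_v: "(\<Sum>i<N. v i) = 0"
  unfolding v_def by (rule sum_deviation)

lemma v_bound: "\<bar>v i\<bar> \<le> 1"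
  using unit_mean_bounds[of N xi] by (cases "xi i") (auto simp: v_def)

lemma Z_sets: "i < N \<Longrightarrow> {\<omega> \<in> space M. Z i \<omega>} \<in> events"
  using simple_functionD(2)[OF simple_function_determined[OF determined_Z eta_subset], of i "{True}"]
  by (simp add: vimage_def Int_def conj_commute)

lemma determined_Z_all: "i < N \<Longrightarrow> determined {..<N} (Z i)"
  using determined_Z eta_subset by (rule determined_mono)

text \<open>The common source of measurability and integrability below: whatever depends on \<omega>
  only through the exposures of the units is determined by the treatments.\<close>

lemma determined_of_all:
  assumes "\<And>\<omega> \<omega>'. (\<And>i. i < N \<Longrightarrow> Z i \<omega> = Z i \<omega>') \<Longrightarrow> F \<omega> = F \<omega>'"
  shows "determined {..<N} F"
proof (rule determinedI)
  fix \<omega> \<omega>' assume "\<omega> \<in> space M" "\<omega>' \<in> space M" "\<And>j. j \<in> {..<N} \<Longrightarrow> X j \<omega> = X j \<omega>'"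
  then have "\<And>i. i < N \<Longrightarrow> Z i \<omega> = Z i \<omega>'"
    using determinedD[OF determined_Z_all] by blast
  then show "F \<omega> = F \<omega>'" by (rule assms)
qed

lemma events_of_all:
  assumes "\<And>\<omega> \<omega>'. (\<And>i. i < N \<Longrightarrow> Z i \<omega> = Z i \<omega>') \<Longrightarrow> Q \<omega> = Q \<omega>'"
  shows "{\<omega> \<in> space M. Q \<omega>} \<in> events"
  using simple_functionD(2)[OF simple_function_determined[OF determined_of_all[OF assms] order_refl], where X="{True}"]
  by (simp add: vimage_def Int_def conj_commute)

lemma T_cong: "(\<And>i. i < N \<Longrightarrow> Z i \<omega> = Z i \<omega>') \<Longrightarrow> T \<omega> = T \<omega>'"
  unfolding T_def T_stat_def by (intro sum.cong) auto

lemma determined_T: "determined {..<N} T"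
  by (rule determined_of_all) (rule T_cong)

lemma L_cong: "(\<And>i. i < N \<Longrightarrow> Z i \<omega> = Z i \<omega>') \<Longrightarrow> L \<omega> = L \<omega>'"
  unfolding L_def exposure_count_def by (intro sum.cong) auto

lemma determined_L: "determined {..<N} L"
  by (rule determined_of_all) (rule L_cong)

lemma contrast_cong:
  assumes "\<And>i. i < N \<Longrightarrow> Z i \<omega> = Z i \<omega>'"
  shows "contrast N y (\<lambda>i. Z i \<omega>) = contrast N y (\<lambda>i. Z i \<omega>')"
proof -
  have "{i. i < N \<and> Z i \<omega>} = {i. i < N \<and> Z i \<omega>'}" "{i. i < N \<and> \<not> Z i \<omega>} = {i. i < N \<and> \<not> Z i \<omega>'}"
    using assms by auto
  then show ?thesis
    using L_cong[OF assms] by (simp only: contrast_def L_def)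
qed

lemma expectation_Z: "i < N \<Longrightarrow> expectation (\<lambda>\<omega>. of_bool (Z i \<omega>)) = p"
proof -
  assume i: "i < N"
  have "expectation (\<lambda>\<omega>. of_bool (Z i \<omega>) :: real) = expectation (indicator {\<omega> \<in> space M. Z i \<omega>})"
    by (intro Bochner_Integration.integral_cong) (auto simp: indicator_def)
  then show ?thesis using Z_sets[OF i] prob_Z[OF i] by simp
qed

text \<open>The weights sum to 0 and all units share the exposure probability \<open>p\<close>, so
  each indicator may be centred without changing \<open>T\<close>. This presents \<open>T\<close> as
  a sum of mean-zero local terms.\<close>

lemma T_eq: "T \<omega> = (\<Sum>i<N. v i * (of_bool (Z i \<omega>) - p))"
proof -
  have "(\<Sum>i<N. v i * (of_bool (Z i \<omega>) - p)) = (\<Sum>i<N. v i * of_bool (Z i \<omega>)) - (\<Sum>i<N. v i) * p"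
    by (simp only: right_diff_distrib sum_subtractf sum_distrib_right)
  then show ?thesis unfolding sum_v T_def T_stat_def v_def[symmetric] by simp
qed

lemma integrable_of_all:
  fixes F :: "'a \<Rightarrow> real"
  assumes "\<And>\<omega> \<omega>'. (\<And>i. i < N \<Longrightarrow> Z i \<omega> = Z i \<omega>') \<Longrightarrow> F \<omega> = F \<omega>'"
  shows "integrable M F"
  using determined_of_all[OF assms] order_refl by (rule integrable_determined)

lemma integrable_Z: "i < N \<Longrightarrow> integrable M (\<lambda>\<omega>. of_bool (Z i \<omega>) :: real)"
  by (rule integrable_of_all) simp

lemma expectation_T: "expectation T = 0"
proof -
  have "expectation T = (\<Sum>i<N. expectation (\<lambda>\<omega>. v i * (of_bool (Z i \<omega>) - p)))"
    unfolding T_eq[abs_def] using integrable_Z by (intro Bochner_Integration.integral_sum) simp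
  also have "\<dots> = 0"
    using integrable_Z expectation_Z by (intro sum.neutral) (simp add: prob_space)
  finally show ?thesis .
qed

lemma variance_T: "variance T = expectation (\<lambda>\<omega>. (T \<omega>)\<^sup>2)"
  by (simp add: expectation_T)

lemma sd_sq_ge: "c * real N \<le> sd\<^sup>2"
  using variance_ge variance_positive[of T] by (simp add: sd_def T_def[abs_def])

lemma sd_ge: "sqrt (c * real N) \<le> sd"
  using sd_sq_ge by (intro real_le_lsqrt) (simp_all add: sd_def)

lemma sd_pos: "0 < sd"
proof -
  have "0 < sqrt (c * real N)" using c_pos N_pos by simp
  then show ?thesis using sd_ge by linarith
qed

text \<open>If \<open>p\<close> were 0 or 1, no unit's exposure would vary and neither would
  \<open>T\<close>. Quantitatively, Cauchy-Schwarz bounds the variance of \<open>T\<close> by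
  \<open>(real N)\<^sup>2 * (p * (1 - p))\<close>; the loss of a factor \<open>N\<close> is
  harmless, as only positivity is read off.\<close>

lemma p_bounds: "0 < p" "p < 1"
proof -
  have "sd\<^sup>2 = expectation (\<lambda>\<omega>. (T \<omega>)\<^sup>2)"
    using variance_positive[of T] by (simp add: sd_def expectation_T)
  also have "\<dots> \<le> expectation (\<lambda>\<omega>. \<Sum>i<N. real N * (of_bool (Z i \<omega>) - p)\<^sup>2)"
  proof (rule integral_mono)
    show "integrable M (\<lambda>\<omega>. (T \<omega>)\<^sup>2)"
      by (rule integrable_determined[OF determined_comp[OF determined_T] order_refl])
    show "integrable M (\<lambda>\<omega>. \<Sum>i<N. real N * (of_bool (Z i \<omega>) - p)\<^sup>2)"
      by (rule integrable_of_all, rule sum.cong) auto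
    fix \<omega>
    have "(T \<omega>)\<^sup>2 \<le> (\<Sum>i<N. (v i * (of_bool (Z i \<omega>) - p))\<^sup>2) * real (card {..<N})"
      unfolding T_eq by (rule sum_squared_le_sum_of_squares)
    also have "\<dots> \<le> (\<Sum>i<N. (of_bool (Z i \<omega>) - p)\<^sup>2) * real (card {..<N})"
      using v_bound by (intro mult_right_mono sum_mono)
        (auto simp: power_mult_distrib abs_square_le_1 intro!: mult_left_le_one_le)
    finally show "(T \<omega>)\<^sup>2 \<le> (\<Sum>i<N. real N * (of_bool (Z i \<omega>) - p)\<^sup>2)"
      by (simp add: sum_distrib_left[symmetric] mult.commute)
  qed
  also have "\<dots> = (\<Sum>i<N. expectation (\<lambda>\<omega>. real N * (of_bool (Z i \<omega>) - p)\<^sup>2))"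
    by (intro Bochner_Integration.integral_sum integrable_of_all) simp
  also have "\<dots> = (\<Sum>i<N. real N * (p * (1 - p)))"
  proof (intro sum.cong refl)
    fix i assume i: "i \<in> {..<N}"
    have "expectation (\<lambda>\<omega>. real N * (of_bool (Z i \<omega>) - p)\<^sup>2)
        = expectation (\<lambda>\<omega>. real N * ((1 - 2 * p) * of_bool (Z i \<omega>) + p\<^sup>2))"
      by (intro Bochner_Integration.integral_cong) (auto simp: power2_eq_square algebra_simps)
    also have "\<dots> = real N * ((1 - 2 * p) * p + p\<^sup>2)"
      using i integrable_Z expectation_Z by (simp add: prob_space)
    finally show "expectation (\<lambda>\<omega>. real N * (of_bool (Z i \<omega>) - p)\<^sup>2) = real N * (p * (1 - p))"
      by (simp add: power2_eq_square algebra_simps)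
  qed
  finally have "sd\<^sup>2 \<le> (real N)\<^sup>2 * (p * (1 - p))"
    by (simp add: power2_eq_square mult.assoc)
  moreover have "0 < sd\<^sup>2"
    using sd_pos by simp
  ultimately have "0 < (real N)\<^sup>2 * (p * (1 - p))"
    by linarith
  then have "0 < p * (1 - p)"
    using N_pos by (simp add: zero_less_mult_iff)
  then show "0 < p" "p < 1"
    by (auto simp: zero_less_mult_iff)
qed

text \<open>Since \<open>T\<close> has mean 0, its variance involves the raw second moments stored
  in \<open>P\<close>, without subtracting products of means.\<close>

lemma sd_le: "sd / real N \<le> sqrt (lambda1 M N Z / real N) / 2"
proof -
  have "variance T = expectation (\<lambda>\<omega>. \<Sum>i<N. \<Sum>j<N. v i * v j * of_bool (Z i \<omega> \<and> Z j \<omega>))"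
    unfolding variance_T
    unfolding T_def T_stat_def v_def[symmetric] power2_eq_square sum_product
    by (intro Bochner_Integration.integral_cong sum.cong refl) (simp only: of_bool_conj mult_ac)
  also have "\<dots> = (\<Sum>i<N. \<Sum>j<N. expectation (\<lambda>\<omega>. v i * v j * of_bool (Z i \<omega> \<and> Z j \<omega>)))"
  proof -
    have int: "integrable M (\<lambda>\<omega>. v i * v j * of_bool (Z i \<omega> \<and> Z j \<omega>))" if "i < N" "j < N" for i j
      using that by (intro integrable_of_all) simp
    have "expectation (\<lambda>\<omega>. \<Sum>i<N. \<Sum>j<N. v i * v j * of_bool (Z i \<omega> \<and> Z j \<omega>))
        = (\<Sum>i<N. expectation (\<lambda>\<omega>. \<Sum>j<N. v i * v j * of_bool (Z i \<omega> \<and> Z j \<omega>)))"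
      by (intro Bochner_Integration.integral_sum Bochner_Integration.integrable_sum int)
        (simp_all only: lessThan_iff)
    also have "\<dots> = (\<Sum>i<N. \<Sum>j<N. expectation (\<lambda>\<omega>. v i * v j * of_bool (Z i \<omega> \<and> Z j \<omega>)))"
      by (intro sum.cong refl Bochner_Integration.integral_sum int) (simp_all only: lessThan_iff)
    finally show ?thesis .
  qed
  also have "\<dots> = (\<Sum>i<N. \<Sum>j<N. joint_exposure_matrix M N Z $$ (i, j) * v i * v j)"
  proof (intro sum.cong refl)
    fix i j assume ij: "i \<in> {..<N}" "j \<in> {..<N}"
    have "expectation (\<lambda>\<omega>. of_bool (Z i \<omega> \<and> Z j \<omega>)) = expectation (indicator {\<omega> \<in> space M. Z i \<omega> \<and> Z j \<omega>})"
      by (intro Bochner_Integration.integral_cong) (auto simp: indicator_def)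
    also have "\<dots> = prob {\<omega> \<in> space M. Z i \<omega> \<and> Z j \<omega>}"
    proof -
      have "{\<omega> \<in> space M. Z i \<omega> \<and> Z j \<omega>} \<in> events"
        by (rule events_of_all) (use ij in simp)
      then show ?thesis by simp
    qed
    finally show "expectation (\<lambda>\<omega>. v i * v j * of_bool (Z i \<omega> \<and> Z j \<omega>))
        = joint_exposure_matrix M N Z $$ (i, j) * v i * v j"
      using ij by (simp add: joint_exposure_matrix_def)
  qed
  also have "\<dots> \<le> lambda1 M N Z * (\<Sum>i<N. (v i)\<^sup>2)"
    using N_pos sum_v by (rule centered_quadratic_form_le_lambda1)
  finally have le: "sd\<^sup>2 \<le> lambda1 M N Z * (\<Sum>i<N. (v i)\<^sup>2)"
    using variance_positive[of T] by (simp add: sd_def)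
  \<comment> \<open>Positivity of \<open>lambda1\<close> is recovered from the positive variance; it
    is needed to enlarge the sum of squares to \<open>real N / 4\<close> inside the product.\<close>
  have "0 < sd\<^sup>2" using sd_pos by simp
  with le have "0 < lambda1 M N Z * (\<Sum>i<N. (v i)\<^sup>2)" by linarith
  moreover have "0 \<le> (\<Sum>i<N. (v i)\<^sup>2)" by (intro sum_nonneg) simp
  ultimately have "0 < lambda1 M N Z" by (auto simp: zero_less_mult_iff)
  then have "lambda1 M N Z * (\<Sum>i<N. (v i)\<^sup>2) \<le> lambda1 M N Z * (real N / 4)"
    using sum_sq_deviation[of xi N] by (intro mult_left_mono) (auto simp: v_def)
  with le have "sd\<^sup>2 \<le> lambda1 M N Z * (real N / 4)" by linarith
  then have "(sd / real N)\<^sup>2 \<le> lambda1 M N Z / real N / 4"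
    using N_pos by (simp add: power_divide field_simps power2_eq_square)
  then have "sd / real N \<le> sqrt (lambda1 M N Z / real N / 4)"
    by (rule real_le_rsqrt)
  moreover have "sqrt (x / 4) = sqrt x / 2" for x :: real
    by (simp add: real_sqrt_divide)
  ultimately show ?thesis by (simp only:)
qed

section \<open>Standardised summands and coverage at a fixed population size\<close>

definition U :: "nat \<Rightarrow> 'a \<Rightarrow> real" where
  "U i \<omega> = v i * (of_bool (Z i \<omega>) - p) / sd"

lemma sum_U: "(\<Sum>i<N. U i \<omega>) = T \<omega> / sd"
  by (simp add: U_def T_eq sum_divide_distrib)

text \<open>Both \<open>v i\<close> and the centred indicator are at most 1 in absolute value, while
  the variance assumption gives \<open>sd\<close> at least \<open>sqrt (c * real N)\<close>; hence
  the bound on the summands.\<close>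

lemma locally_dependent_U:
  "locally_dependent_sum M {..<N} X {..<N} eta U (1 / sqrt (c * real N)) d"
proof unfold_locales
  fix i assume i: "i \<in> {..<N}"
  then show "determined (eta i) (U i)"
    using determined_comp[OF determined_Z, where k="\<lambda>z. v i * (of_bool z - p) / sd"]
    unfolding U_def[abs_def] by simp
  show "expectation (U i) = 0"
    unfolding U_def[abs_def] using i integrable_Z expectation_Z by (simp add: prob_space)
  show "\<bar>U i \<omega>\<bar> \<le> 1 / sqrt (c * real N)" for \<omega>
  proof -
    have "\<bar>of_bool (Z i \<omega>) - p\<bar> \<le> 1" using p_bounds by (cases "Z i \<omega>") auto
    then have "\<bar>v i * (of_bool (Z i \<omega>) - p)\<bar> \<le> 1"
      unfolding abs_mult using v_bound by (intro mult_le_one) auto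
    then have "\<bar>U i \<omega>\<bar> \<le> 1 / sd"
      using sd_pos by (simp add: U_def divide_right_mono)
    also have "\<dots> \<le> 1 / sqrt (c * real N)"
      using sd_ge c_pos N_pos by (intro divide_left_mono mult_pos_pos sd_pos) auto
    finally show ?thesis .
  qed
qed (use eta_subset degree c_pos in auto)

lemma expectation_sum_U_sq: "expectation (\<lambda>\<omega>. (\<Sum>i<N. U i \<omega>)\<^sup>2) = 1"
proof -
  have "expectation (\<lambda>\<omega>. (T \<omega>)\<^sup>2) = sd\<^sup>2"
    using variance_positive[of T] by (simp add: sd_def variance_T)
  then show ?thesis
    using sd_pos by (simp add: sum_U power_divide)
qed

text \<open>The bounded degree keeps the variance of \<open>L\<close> of order \<open>N\<close>, so
  Chebyshev's inequality leaves a probability of order 1/N; the 4 comes from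
  \<open>variance_sum_le\<close> with \<open>C = 1\<close>.\<close>

lemma prob_L_deviation:
  assumes "\<delta> > 0"
  shows "prob {\<omega> \<in> space M. \<delta> \<le> \<bar>L \<omega> / real N - p\<bar>} \<le> 4 * real d / \<delta>\<^sup>2 / real N"
proof -
  have eL: "expectation L = real N * p"
  proof -
    have "expectation L = (\<Sum>i<N. expectation (\<lambda>\<omega>. of_bool (Z i \<omega>)))"
      unfolding L_def[abs_def] exposure_count_def using integrable_Z by (intro Bochner_Integration.integral_sum) simp
    then show ?thesis using expectation_Z by simp
  qed
  have "variance L \<le> real (card {..<N}) * real d * (4 * 1\<^sup>2)"
    unfolding L_def[abs_def] exposure_count_def
    by (rule variance_sum_le[of "{..<N}" eta])
      (use determined_comp[OF determined_Z, where k=of_bool] eta_subset degree in auto)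
  then have var: "variance L \<le> 4 * real N * real d" by simp
  have "{\<omega> \<in> space M. \<delta> \<le> \<bar>L \<omega> / real N - p\<bar>} = {\<omega> \<in> space M. real N * \<delta> \<le> \<bar>L \<omega> - expectation L\<bar>}"
  proof -
    have "\<bar>L \<omega> / real N - p\<bar> = \<bar>L \<omega> - expectation L\<bar> / real N" for \<omega>
    proof -
      have "L \<omega> / real N - p = (L \<omega> - expectation L) / real N"
        using N_pos unfolding eL by (simp add: field_simps)
      then show ?thesis by simp
    qed
    then show ?thesis using N_pos by (simp add: pos_le_divide_eq mult.commute)
  qed
  also have "prob \<dots> \<le> variance L / (real N * \<delta>)\<^sup>2"
    by (rule Chebyshev_inequality[OF random_variable_determined[OF determined_L order_refl]
          integrable_determined[OF determined_comp[OF determined_L, where k="\<lambda>x. x\<^sup>2"] order_refl]])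
      (use assms N_pos in simp)
  also have "\<dots> \<le> (4 * real N * real d) / (real N * \<delta>)\<^sup>2"
    using var by (intro divide_right_mono) auto
  also have "\<dots> = 4 * real d / \<delta>\<^sup>2 / real N"
    using N_pos by (simp add: power_mult_distrib power2_eq_square)
  finally show ?thesis .
qed

text \<open>On the event that the exposed fraction \<open>L / N\<close> is close to \<open>p\<close>, the contrast is the
  standardised statistic times a factor which is at most \<open>(1 + \<epsilon>) sd / (N p (1 - p))\<close>.\<close>

lemma contrast_le:
  assumes z: "0 \<le> z" and eps: "0 < \<epsilon>"
    and x: "0 < L \<omega> / real N" "L \<omega> / real N < 1"
      "p * (1 - p) \<le> (1 + \<epsilon>) * (L \<omega> / real N * (1 - L \<omega> / real N))"
  shows "T \<omega> / sd \<le> z / (1 + \<epsilon>) \<Longrightarrow> contrast N xi (\<lambda>i. Z i \<omega>)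
      \<le> z / (2 * p * (1 - p)) * sqrt (lambda1 M N Z / real N)"
    and "\<bar>T \<omega> / sd\<bar> \<le> z / (1 + \<epsilon>) \<Longrightarrow> \<bar>contrast N xi (\<lambda>i. Z i \<omega>)\<bar>
      \<le> z / (2 * p * (1 - p)) * sqrt (lambda1 M N Z / real N)"
proof -
  define x where "x = L \<omega> / real N"
  define W where "W = T \<omega> / sd"
  define b where "b = sd / real N / (x * (1 - x))"
  have x: "0 < x" "x < 1" "p * (1 - p) \<le> (1 + \<epsilon>) * (x * (1 - x))"
    using assms by (auto simp: x_def)
  have pp: "0 < p * (1 - p)" using p_bounds by simp
  have xx: "0 < x * (1 - x)" using x by simp
  have "L \<omega> = real N * x" using N_pos by (simp add: x_def)
  moreover have "0 < L \<omega>" "L \<omega> < real N"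
    using x N_pos by (simp_all add: x_def field_simps)
  ultimately have "contrast N xi (\<lambda>i. Z i \<omega>) = real N * T \<omega> / (real N * x * (real N - real N * x))"
    using contrast_eq[of N "\<lambda>i. Z i \<omega>" xi] by (simp add: L_def T_def)
  also have "\<dots> = T \<omega> / real N / (x * (1 - x))"
  proof -
    have "real N * x * (real N - real N * x) = real N * (real N * (x * (1 - x)))"
      by (simp add: algebra_simps)
    then show ?thesis using N_pos by simp
  qed
  also have "\<dots> = W * b"
    using sd_pos by (simp add: W_def b_def)
  finally have contrast: "contrast N xi (\<lambda>i. Z i \<omega>) = W * b" .
  have b_pos: "0 < b" using sd_pos N_pos xx by (simp add: b_def)
  have "z / (1 + \<epsilon>) * b = z * (sd / real N) / ((1 + \<epsilon>) * (x * (1 - x)))"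
    by (simp add: b_def)
  \<comment> \<open>The shrunk threshold leaves 1 + \<epsilon> in the denominator, exactly the slack
    that compares \<open>x * (1 - x)\<close> with \<open>p * (1 - p)\<close>.\<close>
  also have "\<dots> \<le> z * (sd / real N) / (p * (1 - p))"
  proof (rule divide_left_mono[OF x(3)])
    show "0 \<le> z * (sd / real N)" using z sd_pos by simp
    show "0 < (1 + \<epsilon>) * (x * (1 - x)) * (p * (1 - p))"
      by (intro mult_pos_pos[OF mult_pos_pos]) (use eps xx pp in simp_all)
  qed
  \<comment> \<open>The sign of \<open>z\<close> is essential here, because \<open>sd\<close> is
    bounded only from above.\<close>
  also have "\<dots> \<le> z * (sqrt (lambda1 M N Z / real N) / 2) / (p * (1 - p))"
    using z sd_le pp by (intro divide_right_mono mult_left_mono) auto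
  also have "\<dots> = z / (2 * p * (1 - p)) * sqrt (lambda1 M N Z / real N)"
    by simp
  finally have le: "z / (1 + \<epsilon>) * b \<le> z / (2 * p * (1 - p)) * sqrt (lambda1 M N Z / real N)" .
  show "contrast N xi (\<lambda>i. Z i \<omega>) \<le> z / (2 * p * (1 - p)) * sqrt (lambda1 M N Z / real N)"
    if "T \<omega> / sd \<le> z / (1 + \<epsilon>)"
    unfolding contrast using mult_right_mono[OF that, of b] b_pos le by (simp add: W_def)
  show "\<bar>contrast N xi (\<lambda>i. Z i \<omega>)\<bar> \<le> z / (2 * p * (1 - p)) * sqrt (lambda1 M N Z / real N)"
    if "\<bar>T \<omega> / sd\<bar> \<le> z / (1 + \<epsilon>)"
    unfolding contrast abs_mult using mult_right_mono[OF that, of b] b_pos le by (simp add: W_def)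
qed

end

context exposure_design
begin

lemma cdf_sum_U: "cdf (distr M borel (\<lambda>\<omega>. \<Sum>i<N. U i \<omega>)) a = prob {\<omega> \<in> space M. T \<omega> / sd \<le> a}"
proof -
  have "random_variable borel (\<lambda>\<omega>. T \<omega> / sd)"
    by (rule random_variable_determined[OF determined_comp[OF determined_T, where k="\<lambda>x. x / sd"] order_refl])
  then show ?thesis
    unfolding cdf_def sum_U
    by (subst measure_distr) (auto intro!: arg_cong[where f=prob])
qed

text \<open>Off the event \<open>?bad\<close>, of probability at most \<open>r\<close>, a bound on
  \<open>T / sd\<close> by the shrunk quantile implies the desired bound on the contrast. Taking
  \<delta> as a parameter keeps its choice independent of \<open>N\<close>.\<close>

lemma prob_contrast_ge:
  assumes z: "0 \<le> z" and eps: "0 < \<epsilon>" and \<delta>: "0 < \<delta>"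
    and near: "\<And>x. \<bar>x - p\<bar> < \<delta> \<Longrightarrow> 0 < x \<and> x < 1 \<and> p * (1 - p) \<le> (1 + \<epsilon>) * (x * (1 - x))"
  defines "w \<equiv> z / (2 * p * (1 - p)) * sqrt (lambda1 M N Z / real N)"
    and "F \<equiv> cdf (distr M borel (\<lambda>\<omega>. \<Sum>i<N. U i \<omega>))"
    and "r \<equiv> 4 * real d / \<delta>\<^sup>2 / real N"
  shows "F (z / (1 + \<epsilon>)) - r \<le> prob {\<omega> \<in> space M. contrast N xi (\<lambda>i. Z i \<omega>) \<le> w}"
    and "F (z / (1 + \<epsilon>)) - F (- (z / (1 + \<epsilon>))) - r
      \<le> prob {\<omega> \<in> space M. \<bar>contrast N xi (\<lambda>i. Z i \<omega>)\<bar> \<le> w}"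
proof -
  let ?bad = "{\<omega> \<in> space M. \<delta> \<le> \<bar>L \<omega> / real N - p\<bar>}"
  let ?a = "z / (1 + \<epsilon>)"
  let ?W = "\<lambda>a. {\<omega> \<in> space M. T \<omega> / sd \<le> a}"
  let ?W2 = "{\<omega> \<in> space M. \<bar>T \<omega> / sd\<bar> \<le> ?a}"
  let ?C = "{\<omega> \<in> space M. contrast N xi (\<lambda>i. Z i \<omega>) \<le> w}"
  let ?C2 = "{\<omega> \<in> space M. \<bar>contrast N xi (\<lambda>i. Z i \<omega>)\<bar> \<le> w}"
  have det: "determined {..<N} (\<lambda>\<omega>. contrast N xi (\<lambda>i. Z i \<omega>))"
    by (rule determined_of_all) (rule contrast_cong)
  note [measurable] = random_variable_determined[OF determined_T order_refl]
    random_variable_determined[OF determined_L order_refl] random_variable_determined[OF det order_refl]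
  have bad: "prob ?bad \<le> r"
    using prob_L_deviation[OF \<delta>] by (simp add: r_def)
  have le: "prob A \<le> prob C + r" if "A \<subseteq> C \<union> ?bad" "A \<in> events" "C \<in> events" for A C
  proof -
    have "prob A \<le> prob (C \<union> ?bad)"
      using that by (intro finite_measure_mono) auto
    also have "\<dots> \<le> prob C + prob ?bad"
      using that by (intro measure_Un_le) auto
    finally show ?thesis using bad by simp
  qed
  have good: "0 < L \<omega> / real N" "L \<omega> / real N < 1"
      "p * (1 - p) \<le> (1 + \<epsilon>) * (L \<omega> / real N * (1 - L \<omega> / real N))"
    if "\<omega> \<in> space M" "\<omega> \<notin> ?bad" for \<omega>
    using near[of "L \<omega> / real N"] that by auto
  have "?W ?a \<subseteq> ?C \<union> ?bad"
    using contrast_le(1)[OF z eps good] unfolding w_def by blast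
  then have "prob (?W ?a) \<le> prob ?C + r"
    by (rule le) auto
  then show "F ?a - r \<le> prob ?C"
    unfolding F_def cdf_sum_U by simp
  have "?W2 \<subseteq> ?C2 \<union> ?bad"
    using contrast_le(2)[OF z eps good] unfolding w_def by blast
  then have 2: "prob ?W2 \<le> prob ?C2 + r"
    by (rule le) auto
  \<comment> \<open>Covering by the lower tail up to and including \<open>- ?a\<close> gives a bound
    in values of the distribution function alone, whatever mass sits at \<open>- ?a\<close>.\<close>
  have "prob (?W ?a) \<le> prob (?W2 \<union> ?W (- ?a))"
    by (intro finite_measure_mono) auto
  also have "\<dots> \<le> prob ?W2 + prob (?W (- ?a))"
    by (intro measure_Un_le) auto
  finally show "F ?a - F (- ?a) - r \<le> prob ?C2"
    unfolding F_def cdf_sum_U using 2 by linarith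
qed

end

section \<open>Asymptotic coverage\<close>

text \<open>At \<open>x = p\<close> the inequality is strict because \<epsilon> is positive, so it
  persists near \<open>p\<close> by continuity.\<close>

lemma bernoulli_variance_near:
  fixes p \<epsilon> :: real
  assumes "0 < p" "p < 1" "0 < \<epsilon>"
  shows "\<exists>\<delta>>0. \<forall>x. \<bar>x - p\<bar> < \<delta> \<longrightarrow> 0 < x \<and> x < 1 \<and> p * (1 - p) \<le> (1 + \<epsilon>) * (x * (1 - x))"
proof -
  have "((\<lambda>x. (1 + \<epsilon>) * (x * (1 - x))) \<longlongrightarrow> (1 + \<epsilon>) * (p * (1 - p))) (nhds p)"
    by (intro tendsto_intros filterlim_ident)
  moreover have "p * (1 - p) < (1 + \<epsilon>) * (p * (1 - p))"
    using assms by simp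
  ultimately have "\<forall>\<^sub>F x in nhds p. p * (1 - p) < (1 + \<epsilon>) * (x * (1 - x))"
    by (rule order_tendstoD)
  moreover have "\<forall>\<^sub>F x in nhds p. 0 < x" "\<forall>\<^sub>F x in nhds p. x < 1"
    using order_tendstoD[OF filterlim_ident] assms by blast+
  ultimately have "\<forall>\<^sub>F x in nhds p. 0 < x \<and> x < 1 \<and> p * (1 - p) \<le> (1 + \<epsilon>) * (x * (1 - x))"
    by eventually_elim simp
  then show ?thesis
    unfolding eventually_nhds_metric dist_real_def .
qed

text \<open>The liminf on the right is free of \<epsilon>. So \<open>n\<close> tends to infinity at
  fixed \<epsilon>, and then \<epsilon> runs through \<open>inverse (real (Suc k))\<close>, where
  continuity of \<open>h\<close> at \<open>z\<close> recovers \<open>h z\<close>.\<close>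

lemma le_liminf_of_shrunk_bounds:
  fixes h :: "real \<Rightarrow> real" and f :: "nat \<Rightarrow> real"
  assumes cont: "isCont h z"
    and bound: "\<And>\<epsilon>. 0 < \<epsilon> \<Longrightarrow> \<exists>g. g \<longlonglongrightarrow> h (z / (1 + \<epsilon>)) \<and> (\<forall>\<^sub>F n in sequentially. g n \<le> f n)"
  shows "ereal (h z) \<le> liminf (\<lambda>n. ereal (f n))"
proof -
  have le: "ereal (h (z / (1 + \<epsilon>))) \<le> liminf (\<lambda>n. ereal (f n))" if "0 < \<epsilon>" for \<epsilon>
  proof -
    obtain g where g: "g \<longlonglongrightarrow> h (z / (1 + \<epsilon>))" "\<forall>\<^sub>F n in sequentially. g n \<le> f n"
      using bound[OF \<open>0 < \<epsilon>\<close>] by (elim exE conjE) (rule that)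
    have "ereal (h (z / (1 + \<epsilon>))) = liminf (\<lambda>n. ereal (g n))"
      using g(1) by (intro lim_imp_Liminf[symmetric]) simp_all
    also have "\<dots> \<le> liminf (\<lambda>n. ereal (f n))"
      using g(2) by (intro Liminf_mono) (auto elim: eventually_mono)
    finally show ?thesis .
  qed
  have "(\<lambda>k. z / (1 + inverse (real (Suc k)))) \<longlonglongrightarrow> z / (1 + 0)"
    by (intro tendsto_intros LIMSEQ_inverse_real_of_nat) simp
  then have "(\<lambda>k. h (z / (1 + inverse (real (Suc k))))) \<longlonglongrightarrow> h z"
    by (intro isCont_tendsto_compose[OF cont]) simp
  then have "(\<lambda>k. ereal (h (z / (1 + inverse (real (Suc k)))))) \<longlonglongrightarrow> ereal (h z)"
    by simp
  then show ?thesis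
    by (rule LIMSEQ_le_const2) (use le in auto)
qed

text \<open>The added 1 accounts for unit \<open>i\<close> itself, which the sum leaves out.
  Finiteness of \<open>eta i\<close> matters: otherwise \<open>card\<close> could be 0 on a nonempty
  intersection.\<close>

lemma card_neighbourhood_le:
  fixes N :: nat and eta :: "nat \<Rightarrow> nat set"
  assumes i: "i < N" and self: "\<And>j. j < N \<Longrightarrow> j \<in> eta j \<and> eta j \<subseteq> {..<N}"
    and D: "(\<Sum>j \<in> {..<N} - {i}. of_bool (card (eta i \<inter> eta j) > 0)) \<le> (D :: real)"
  shows "card {j \<in> {..<N}. eta i \<inter> eta j \<noteq> {}} \<le> nat \<lfloor>D\<rfloor> + 1"
proof -
  let ?A = "{j \<in> {..<N} - {i}. eta i \<inter> eta j \<noteq> {}}"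
  have fin: "finite (eta i)" by (rule finite_subset[OF conjunct2[OF self[OF i]] finite_lessThan])
  have "?A = ({..<N} - {i}) \<inter> {j. card (eta i \<inter> eta j) > 0}"
    using fin by (auto simp: card_gt_0_iff)
  then have "real (card ?A) = (\<Sum>j \<in> {..<N} - {i}. of_bool (card (eta i \<inter> eta j) > 0))"
    by (simp only: sum_of_bool_eq finite_Diff finite_lessThan)
  then have "card ?A \<le> nat \<lfloor>D\<rfloor>"
    using D by linarith
  moreover have "{j \<in> {..<N}. eta i \<inter> eta j \<noteq> {}} \<subseteq> insert i ?A"
    by auto
  then have "card {j \<in> {..<N}. eta i \<inter> eta j \<noteq> {}} \<le> card (insert i ?A)"
    by (intro card_mono) auto
  moreover have "card (insert i ?A) \<le> card ?A + 1"
    by (simp add: card_insert_if)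
  ultimately show ?thesis by linarith
qed

text \<open>Each population size has its own probability space, and convergence to at least 1 -
  \<open>alpha\<close> is a lower bound on the liminf. The premise \<open>alpha \<le> 1 / 2\<close>
  of the one-sided claim makes its quantile nonnegative: with a negative quantile, passing from the
  standard deviation to its upper bound would lower the threshold. The two-sided claim uses the
  level 1 - \<open>alpha\<close>/2, which always exceeds 1/2.\<close>

theorem theorem5:
  fixes M :: "nat \<Rightarrow> 'a measure"
    and rho :: "nat \<Rightarrow> real"
    and X Z Y :: "nat \<Rightarrow> nat \<Rightarrow> 'a \<Rightarrow> bool"
    and f h :: "nat \<Rightarrow> nat \<Rightarrow> (nat \<Rightarrow> bool) \<Rightarrow> bool"
    and eta :: "nat \<Rightarrow> nat \<Rightarrow> nat set"
    and xi :: "nat \<Rightarrow> nat \<Rightarrow> bool"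
    and c D p alpha :: real
  assumes prob: "\<And>N. prob_space (M N)"
    and rho: "\<And>N. 0 \<le> rho N \<and> rho N \<le> 1"
    and X_indep: "\<And>N. prob_space.indep_vars (M N) (\<lambda>_. count_space UNIV) (X N) {..<N}"
    and X_bernoulli: "\<And>N i. i < N \<Longrightarrow>
      distr (M N) (count_space UNIV) (X N i) = measure_pmf (bernoulli_pmf (rho N))"
    and Y: "\<And>N i \<omega>. i < N \<Longrightarrow> \<omega> \<in> space (M N) \<Longrightarrow>
      Y N i \<omega> = f N i (restrict (\<lambda>j. X N j \<omega>) {..<N})"
    and xi: "\<And>N i. i < N \<Longrightarrow> xi N i = f N i (restrict (\<lambda>j. False) {..<N})"
    and eta: "\<And>N i. i < N \<Longrightarrow> i \<in> eta N i \<and> eta N i \<subseteq> {..<N}"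
    and Z: "\<And>N i \<omega>. i < N \<Longrightarrow> \<omega> \<in> space (M N) \<Longrightarrow>
      Z N i \<omega> = h N i (restrict (\<lambda>j. X N j \<omega>) (eta N i))"
    and c: "0 < c"
    and var_T: "\<forall>\<^sub>F N in sequentially.
      prob_space.variance (M N) (\<lambda>\<omega>. T_stat N (\<lambda>i. Z N i \<omega>) (xi N)) \<ge> c * real N"
    and degree: "\<forall>\<^sub>F N in sequentially. \<forall>i<N.
      (\<Sum>j \<in> {..<N} - {i}. of_bool (card (eta N i \<inter> eta N j) > 0)) \<le> D"
    and diag_P: "\<forall>\<^sub>F N in sequentially. \<forall>i<N. joint_exposure_matrix (M N) N (Z N) $$ (i, i) = p"
    and alpha: "0 < alpha" "alpha < 1"
  shows "(alpha \<le> 1 / 2 \<longrightarrow>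
      ereal (1 - alpha) \<le> liminf (\<lambda>N. ereal (measure (M N) {\<omega> \<in> space (M N).
        tau_ZCAT N (\<lambda>i. Y N i \<omega>) (xi N) (\<lambda>i. Z N i \<omega>)
          \<ge> contrast N (\<lambda>i. Y N i \<omega>) (\<lambda>i. Z N i \<omega>)
            - normal_quantile (1 - alpha) / (2 * p * (1 - p)) * sqrt (lambda1 (M N) N (Z N) / real N)})))
    \<and> ereal (1 - alpha) \<le> liminf (\<lambda>N. ereal (measure (M N) {\<omega> \<in> space (M N).
        \<bar>contrast N (\<lambda>i. Y N i \<omega>) (\<lambda>i. Z N i \<omega>)
            - tau_ZCAT N (\<lambda>i. Y N i \<omega>) (xi N) (\<lambda>i. Z N i \<omega>)\<bar>
          \<le> normal_quantile (1 - alpha / 2) / (2 * p * (1 - p)) * sqrt (lambda1 (M N) N (Z N) / real N)}))"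
proof -
  define d where "d = nat \<lfloor>D\<rfloor> + 1"
  have ic: "independent_coordinates (M N) {..<N} (X N)" for N
    using prob X_indep by (simp add: independent_coordinates_def independent_coordinates_axioms_def)
  have det: "independent_coordinates.determined (M N) (X N) (eta N i) (Z N i)" if "i < N" for N i
  proof -
    interpret independent_coordinates "M N" "{..<N}" "X N" by (rule ic)
    show ?thesis
    proof (rule determinedI)
      fix \<omega> \<omega>' assume \<omega>: "\<omega> \<in> space (M N)" "\<omega>' \<in> space (M N)"
        and eq: "\<And>j. j \<in> eta N i \<Longrightarrow> X N j \<omega> = X N j \<omega>'"
      then have "restrict (\<lambda>j. X N j \<omega>) (eta N i) = restrict (\<lambda>j. X N j \<omega>') (eta N i)"
        by (intro restrict_ext)
      then show "Z N i \<omega> = Z N i \<omega>'"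
        unfolding Z[OF that \<omega>(1)] Z[OF that \<omega>(2)] by (rule arg_cong)
    qed
  qed
  have design: "\<forall>\<^sub>F N in sequentially. exposure_design (M N) N (X N) (Z N) (eta N) (xi N) p c d"
    using var_T degree diag_P eventually_gt_at_top[of 0]
  proof eventually_elim
    case (elim N)
    interpret independent_coordinates "M N" "{..<N}" "X N" by (rule ic)
    show ?case
    proof unfold_locales
      show "prob {\<omega> \<in> space (M N). Z N i \<omega>} = p" if "i < N" for i
        using elim(3) that by (simp add: joint_exposure_matrix_def)
      show "card {j \<in> {..<N}. eta N i \<inter> eta N j \<noteq> {}} \<le> d" if "i < N" for i
        unfolding d_def using elim(2) that by (intro card_neighbourhood_le eta) auto
    qed (use det eta c elim in auto)
  qed
  \<comment> \<open>As \<open>p\<close> does not vary with \<open>N\<close>, a single valid design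
    settles its range.\<close>
  then obtain N0 where "exposure_design (M N0) N0 (X N0) (Z N0) (eta N0) (xi N0) p c d"
    using eventually_happens'[OF sequentially_bot] by blast
  then have p: "0 < p" "p < 1"
    using exposure_design.p_bounds by blast+
  \<comment> \<open>An explicit form of the standardised summands, usable for every
    \<open>N\<close>: measurability is required throughout, while the design assumptions hold only
    eventually.\<close>
  define V where "V N i \<omega> = (of_bool (xi N i) - unit_mean N (xi N)) * (of_bool (Z N i \<omega>) - p)
      / sqrt (prob_space.variance (M N) (\<lambda>\<omega>. T_stat N (\<lambda>i. Z N i \<omega>) (xi N)))" for N i \<omega>
  have U_eq: "exposure_design.U (M N) N (Z N) (xi N) p = V N"
    if "exposure_design (M N) N (X N) (Z N) (eta N) (xi N) p c d" for N
  proof (intro ext)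
    fix i \<omega>
    interpret exposure_design "M N" N "X N" "Z N" "eta N" "xi N" p c d by (rule that)
    show "exposure_design.U (M N) N (Z N) (xi N) p i \<omega> = V N i \<omega>"
      unfolding V_def exposure_design.U_def[OF that] v_def sd_def T_def[abs_def] by simp
  qed
  define F where "F N = cdf (distr (M N) borel (\<lambda>\<omega>. \<Sum>i<N. V N i \<omega>))" for N
  have "weak_conv_m (\<lambda>N. distr (M N) borel (\<lambda>\<omega>. \<Sum>i<N. V N i \<omega>)) std_normal_distribution"
  proof (rule weak_conv_locally_dependent_sum[where B="\<lambda>N. 1 / sqrt (c * real N)" and d=d and K="\<lambda>N. {..<N}"])
    fix N
    interpret independent_coordinates "M N" "{..<N}" "X N" by (rule ic)
    have "determined {..<N} (V N i)" if "i < N" for i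
      unfolding V_def[abs_def] using eta[OF that]
      by (intro determined_mono[OF determined_comp[OF det[OF that]]]) auto
    then have "determined {..<N} (\<lambda>\<omega>. \<Sum>i<N. V N i \<omega>)"
      by (intro determined_sum) simp
    then show rv: "random_variable borel (\<lambda>\<omega>. \<Sum>i<N. V N i \<omega>)"
      by (rule random_variable_determined) simp
    show "real_distribution (distr (M N) borel (\<lambda>\<omega>. \<Sum>i<N. V N i \<omega>))"
      using rv by (rule real_distribution_distr)
  next
    show "\<forall>\<^sub>F N in sequentially. locally_dependent_sum (M N) {..<N} (X N) {..<N} (eta N) (V N) (1 / sqrt (c * real N)) d"
      using design by eventually_elim (metis exposure_design.locally_dependent_U U_eq)
    show "\<forall>\<^sub>F N in sequentially. (\<integral>\<omega>. (\<Sum>i<N. V N i \<omega>)\<^sup>2 \<partial>M N) = 1"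
      using design by eventually_elim (metis exposure_design.expectation_sum_U_sq U_eq)
    \<comment> \<open>With summands of order \<open>N\<close> to the power -1/2, the cubic quantity
      is of that same order and the quartic one of order 1/N.\<close>
    show "(\<lambda>N. real (card {..<N}) * (1 / sqrt (c * real N)) ^ 3) \<longlonglongrightarrow> 0"
      unfolding card_lessThan using c by real_asymp
    show "(\<lambda>N. real (card {..<N}) * (1 / sqrt (c * real N)) ^ 4) \<longlonglongrightarrow> 0"
      unfolding card_lessThan using c by real_asymp
  qed
  then have F: "(\<lambda>N. F N a) \<longlonglongrightarrow> cdf std_normal_distribution a" for a
    unfolding weak_conv_m_def weak_conv_def F_def using isCont_cdf_std_normal by blast
  let ?w = "\<lambda>N z. z / (2 * p * (1 - p)) * sqrt (lambda1 (M N) N (Z N) / real N)"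
  let ?\<Phi> = "cdf std_normal_distribution"
  define P1 where "P1 z N = measure (M N) {\<omega> \<in> space (M N). contrast N (xi N) (\<lambda>i. Z N i \<omega>) \<le> ?w N z}" for z N
  define P2 where "P2 z N = measure (M N) {\<omega> \<in> space (M N). \<bar>contrast N (xi N) (\<lambda>i. Z N i \<omega>)\<bar> \<le> ?w N z}" for z N
  have main: "ereal (?\<Phi> z) \<le> liminf (\<lambda>N. ereal (P1 z N))" (is ?one)
    "ereal (?\<Phi> z - ?\<Phi> (- z)) \<le> liminf (\<lambda>N. ereal (P2 z N))" (is ?two)
    if z: "0 \<le> z" for z
  proof -
    have ex: "\<exists>r. r \<longlonglongrightarrow> 0 \<and> (\<forall>\<^sub>F N in sequentially.
        F N (z / (1 + \<epsilon>)) - r N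
          \<le> P1 z N \<and>
        F N (z / (1 + \<epsilon>)) - F N (- (z / (1 + \<epsilon>))) - r N
          \<le> P2 z N)"
      if eps: "0 < \<epsilon>" for \<epsilon>
    proof -
      obtain \<delta> where \<delta>: "0 < \<delta>"
        and near: "\<And>x. \<bar>x - p\<bar> < \<delta> \<Longrightarrow> 0 < x \<and> x < 1 \<and> p * (1 - p) \<le> (1 + \<epsilon>) * (x * (1 - x))"
        using bernoulli_variance_near[OF p eps] by (elim exE conjE) (rule that, assumption, erule allE, erule mp)
      define r where "r N = 4 * real d / \<delta>\<^sup>2 / real N" for N
      have "r \<longlonglongrightarrow> 0"
        unfolding r_def[abs_def] by (rule lim_const_over_n)
      moreover have "\<forall>\<^sub>F N in sequentially.
        F N (z / (1 + \<epsilon>)) - r N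
          \<le> P1 z N \<and>
        F N (z / (1 + \<epsilon>)) - F N (- (z / (1 + \<epsilon>))) - r N
          \<le> P2 z N"
        using design
      proof eventually_elim
        case (elim N)
        show ?case
          using exposure_design.prob_contrast_ge[OF elim z eps \<delta> near]
          unfolding U_eq[OF elim] F_def r_def P1_def P2_def by (rule conjI)
      qed
      ultimately show ?thesis by (intro exI[of _ r] conjI)
    qed
    show ?one
    proof (rule le_liminf_of_shrunk_bounds[OF isCont_cdf_std_normal])
      fix \<epsilon> :: real assume "0 < \<epsilon>"
      from ex[OF this] obtain r where r: "r \<longlonglongrightarrow> 0" and ev: "\<forall>\<^sub>F N in sequentially.
        F N (z / (1 + \<epsilon>)) - r N
          \<le> P1 z N \<and>
        F N (z / (1 + \<epsilon>)) - F N (- (z / (1 + \<epsilon>))) - r N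
          \<le> P2 z N"
        by (elim exE conjE) (rule that)
      show "\<exists>g. g \<longlonglongrightarrow> ?\<Phi> (z / (1 + \<epsilon>)) \<and> (\<forall>\<^sub>F N in sequentially.
          g N \<le> P1 z N)"
        using tendsto_diff[OF F r, of "z / (1 + \<epsilon>)"] eventually_mono[OF ev conjunct1]
        by (intro exI[of _ "\<lambda>N. F N (z / (1 + \<epsilon>)) - r N"] conjI) simp_all
    qed
    show ?two
    proof (rule le_liminf_of_shrunk_bounds[where h="\<lambda>z. ?\<Phi> z - ?\<Phi> (- z)"])
      show "isCont (\<lambda>z. ?\<Phi> z - ?\<Phi> (- z)) z"
        by (intro continuous_intros isCont_cdf_std_normal isCont_o2[OF _ isCont_cdf_std_normal])
      fix \<epsilon> :: real assume "0 < \<epsilon>"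
      from ex[OF this] obtain r where r: "r \<longlonglongrightarrow> 0" and ev: "\<forall>\<^sub>F N in sequentially.
        F N (z / (1 + \<epsilon>)) - r N
          \<le> P1 z N \<and>
        F N (z / (1 + \<epsilon>)) - F N (- (z / (1 + \<epsilon>))) - r N
          \<le> P2 z N"
        by (elim exE conjE) (rule that)
      show "\<exists>g. g \<longlonglongrightarrow> ?\<Phi> (z / (1 + \<epsilon>)) - ?\<Phi> (- (z / (1 + \<epsilon>))) \<and> (\<forall>\<^sub>F N in sequentially.
          g N \<le> P2 z N)"
        using tendsto_diff[OF tendsto_diff[OF F F] r, of "z / (1 + \<epsilon>)" "- (z / (1 + \<epsilon>))"]
          eventually_mono[OF ev conjunct2]
        by (intro exI[of _ "\<lambda>N. F N (z / (1 + \<epsilon>)) - F N (- (z / (1 + \<epsilon>))) - r N"] conjI) simp_all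
    qed
  qed
  have sets1: "{\<omega> \<in> space (M N). tau_ZCAT N (\<lambda>i. Y N i \<omega>) (xi N) (\<lambda>i. Z N i \<omega>)
        \<ge> contrast N (\<lambda>i. Y N i \<omega>) (\<lambda>i. Z N i \<omega>) - w}
      = {\<omega> \<in> space (M N). contrast N (xi N) (\<lambda>i. Z N i \<omega>) \<le> w}" for N w
    by (auto simp: tau_ZCAT_def)
  have sets2: "{\<omega> \<in> space (M N). \<bar>contrast N (\<lambda>i. Y N i \<omega>) (\<lambda>i. Z N i \<omega>)
        - tau_ZCAT N (\<lambda>i. Y N i \<omega>) (xi N) (\<lambda>i. Z N i \<omega>)\<bar> \<le> w}
      = {\<omega> \<in> space (M N). \<bar>contrast N (xi N) (\<lambda>i. Z N i \<omega>)\<bar> \<le> w}" for N w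
    by (auto simp: tau_ZCAT_def)
  show ?thesis
  proof (intro conjI impI)
    assume half: "alpha \<le> 1 / 2"
    have "1 - alpha \<le> ?\<Phi> (normal_quantile (1 - alpha))"
      using alpha by (intro cdf_normal_quantile_ge) auto
    then have "ereal (1 - alpha) \<le> ereal (?\<Phi> (normal_quantile (1 - alpha)))"
      by simp
    also have "\<dots> \<le> liminf (\<lambda>N. ereal (P1 (normal_quantile (1 - alpha)) N))"
      using half alpha by (intro main(1) normal_quantile_nonneg) auto
    finally show "ereal (1 - alpha) \<le> liminf (\<lambda>N. ereal (measure (M N) {\<omega> \<in> space (M N).
        tau_ZCAT N (\<lambda>i. Y N i \<omega>) (xi N) (\<lambda>i. Z N i \<omega>)
          \<ge> contrast N (\<lambda>i. Y N i \<omega>) (\<lambda>i. Z N i \<omega>) - ?w N (normal_quantile (1 - alpha))}))"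
      unfolding sets1 P1_def .
  next
    have "1 - alpha / 2 \<le> ?\<Phi> (normal_quantile (1 - alpha / 2))"
      using alpha by (intro cdf_normal_quantile_ge) auto
    \<comment> \<open>By symmetry the difference is twice the distribution function minus 1, hence
      at least 2 (1 - \<open>alpha\<close>/2) - 1.\<close>
    then have "ereal (1 - alpha)
        \<le> ereal (?\<Phi> (normal_quantile (1 - alpha / 2)) - ?\<Phi> (- normal_quantile (1 - alpha / 2)))"
      unfolding cdf_std_normal_uminus by simp
    also have "\<dots> \<le> liminf (\<lambda>N. ereal (P2 (normal_quantile (1 - alpha / 2)) N))"
      using alpha by (intro main(2) normal_quantile_nonneg) auto
    finally show "ereal (1 - alpha) \<le> liminf (\<lambda>N. ereal (measure (M N) {\<omega> \<in> space (M N).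
        \<bar>contrast N (\<lambda>i. Y N i \<omega>) (\<lambda>i. Z N i \<omega>)
            - tau_ZCAT N (\<lambda>i. Y N i \<omega>) (xi N) (\<lambda>i. Z N i \<omega>)\<bar>
          \<le> ?w N (normal_quantile (1 - alpha / 2))}))"
      unfolding sets2 P2_def .
  qed
qed

end
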